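(* Let $n > 1$ be an integer and let $M$ be an $n \times n$ sign matrix. Then the following are equivalent: (a) There exists an integer $s$ with $1 \le s \le n$ such that $M$ can be conjugated by a permutation matrix into a block matrix of the form $$\begin{pmatrix} A & B \\ B^t & S \end{pmatrix}$$ where $A$ is an $s \times s$ skew-symmetric sign matrix, $S$ is an $(n-s)\times(n-s)$ symmetric sign matrix, $B$ is an $s \times (n-s)$ matrix all of whose entries are $\pm 1$, and $B^t$ denotes the transpose of $B$. (b) There exist distinct odd primes $p_1, p_2, \dots, p_n$ such that $M$ is the quadratic residue matrix associated to $p_1, p_2, \dots, p_n$. (c) There exists an integer $s$ with $1 \le s \le n$ such that the diagonal entries of $M^2$ consist of $s$ occurrences of $n+1-2s$ and $n-s$ occurrences of $n-1$.
   Context: A sign matrix is a square matrix whose diagonal entries are all $0$ and whose off-diagonal entries are all $\pm 1$. The quadratic residue matrix associated to distinct odd (positive) primes $p_1, \dots, p_n$ is the $n \times n$ matrix whose $(i,j)$-entry is the Legendre symbol $\left(\frac{p_i}{p_j}\right)$ (so the diagonal entries are $0$). When $s = n$, the blocks $B$, $B^t$ and $S$ are empty. In (c), the diagonal entries are counted with multiplicity (as a multiset of size $n$); the two values $n+1-2s$ and $n-1$ coincide when $s=1$, in which case the condition says that all $n$ diagonal entries equal $n-1$. *)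

theory Defs
  imports
    "Jordan_Normal_Form.Matrix"
    "HOL-Number_Theory.Residues"
    "HOL-Combinatorics.Permutations"
    "HOL-Library.Multiset"
begin

definition sign_mat :: "nat \<Rightarrow> int mat \<Rightarrow> bool" where
  "sign_mat n M \<longleftrightarrow> M \<in> carrier_mat n n \<and> (\<forall>i<n. M $$ (i, i) = 0) \<and>
     (\<forall>i<n. \<forall>j<n. i \<noteq> j \<longrightarrow> M $$ (i, j) \<in> {1, -1})"

definition symmetric_mat :: "int mat \<Rightarrow> bool" where
  "symmetric_mat M \<longleftrightarrow> transpose_mat M = M"

definition skew_symmetric_mat :: "int mat \<Rightarrow> bool" where
  "skew_symmetric_mat M \<longleftrightarrow> transpose_mat M = - M"

definition permutation_mat :: "nat \<Rightarrow> int mat \<Rightarrow> bool" where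
  "permutation_mat n P \<longleftrightarrow>
     (\<exists>\<pi>. \<pi> permutes {..<n} \<and> P = mat n n (\<lambda>(i, j). if i = \<pi> j then 1 else 0))"

text \<open>
  Rows index the upper argument of the Legendre symbol. The diagonal entries
  vanish because \<open>Legendre a p = 0\<close> whenever \<open>p\<close> divides \<open>a\<close>.
\<close>
definition quadratic_residue_mat :: "nat list \<Rightarrow> int mat" where
  "quadratic_residue_mat ps = mat (length ps) (length ps)
     (\<lambda>(i, j). Legendre (int (ps ! i)) (int (ps ! j)))"

end

theory Submission
  imports Defs "HOL-Analysis.Infinite_Sum" "HOL-Analysis.Uniform_Limit" "HOL-Number_Theory.Number_Theory"
begin

text \<open>
  By quadratic reciprocity, \<open>(p/q) = - (q/p)\<close> exactly when \<open>p\<close> and \<open>q\<close> are both 3 mod 4, so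
  the primes that are 3 mod 4 index the skew block; if there are none, the matrix is symmetric and
  any single index serves as a skew block of size 1. The \<open>i\<close>-th diagonal entry of \<open>M\<^sup>2\<close> is
  \<open>n - 1 - 2 k\<close>, where \<open>k\<close> counts the \<open>j \<noteq> i\<close> with \<open>M\<^sub>j\<^sub>i = - M\<^sub>i\<^sub>j\<close>. Condition (c) says that for
  \<open>s\<close> indices this count is \<open>s - 1\<close> and for the others it is 0; since the relation is symmetric,
  those \<open>s\<close> indices are related to each other and to nothing else.

  To realise a given pattern, the primes are chosen one after the other with prescribed residue
  mod 4 and prescribed Legendre symbols over the earlier ones. That such primes exist needs
  Dirichlet's argument for real characters only: by the Euler product \<open>\<Sum>p. \<psi>(p) p powr - s\<close> is
  \<open>ln L(s, \<psi>)\<close> up to a bounded error, so it stays bounded as \<open>s \<rightarrow> 1\<close> for nontrivial \<open>\<psi>\<close> once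
  \<open>L(1, \<psi>) \<noteq> 0\<close> is known, whereas it diverges for trivial \<open>\<psi>\<close>.
\<close>

subsection \<open>Euler products and Abel summation\<close>

lemma infsum_nat_LIMSEQ:
  fixes g :: "nat \<Rightarrow> real"
  assumes "g summable_on B"
  shows "(\<lambda>x. sum g {n\<in>B. n < x}) \<longlonglongrightarrow> infsum g B"
proof -
  have "(sum g \<longlongrightarrow> infsum g B) (finite_subsets_at_top B)"
    using has_sum_infsum[OF assms] by (simp add: has_sum_def)
  moreover have "filterlim (\<lambda>x. {n\<in>B. n < x}) (finite_subsets_at_top B) sequentially"
    unfolding filterlim_finite_subsets_at_top
  proof (intro allI impI)
    fix X assume X: "finite X \<and> X \<subseteq> B"
    then obtain m where m: "\<forall>n\<in>X. n < m" using finite_nat_set_iff_bounded by blast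
    show "\<forall>\<^sub>F x in sequentially. finite {n \<in> B. n < x} \<and> X \<subseteq> {n \<in> B. n < x} \<and> {n \<in> B. n < x} \<subseteq> B"
      using eventually_ge_at_top[of m] by eventually_elim (use X m in force)
  qed
  ultimately show ?thesis by (rule filterlim_compose)
qed

text \<open>A finite form of the Euler product, sieving by one prime at a time: the multiples of
  \<open>q\<close> among the surviving numbers carry \<open>f q\<close> times the surviving sum, so
  removing them multiplies that sum by \<open>1 - f q\<close>.\<close>

lemma infsum_sieve:
  fixes f :: "nat \<Rightarrow> real"
  assumes mult: "\<And>m n. f (m * n) = f m * f n"
    and summ: "(\<lambda>n. \<bar>f n\<bar>) summable_on {1..}"
    and "finite T" "\<And>p. p \<in> T \<Longrightarrow> prime p"
  shows "infsum f {n\<in>{1..}. \<forall>p\<in>T. \<not> p dvd n} = infsum f {1..} * (\<Prod>p\<in>T. 1 - f p)"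
  using assms(3,4)
proof (induction T rule: finite_induct)
  case empty
  have "{n::nat. Suc 0 \<le> n} = {1..}" by auto
  then show ?case by simp
next
  case (insert q T)
  define A where "A = {n\<in>{1::nat..}. \<forall>p\<in>T. \<not> p dvd n}"
  define A' where "A' = {n\<in>{1::nat..}. \<forall>p\<in>insert q T. \<not> p dvd n}"
  have summ': "f summable_on B" if "B \<subseteq> {1..}" for B
    using summable_on_subset_banach[OF abs_summable_summable[of f] that] summ by simp
  have q: "prime q" using insert.prems by simp
  then have q0: "q > 0" by (rule prime_gt_0_nat)
  have cop: "coprime p q" if "p \<in> T" for p
    using that insert.prems insert.hyps(2) by (metis insertCI primes_coprime)
  \<comment> \<open>Multiplying by \<open>q\<close> or cancelling it does not affect divisibility by
    the primes of \<open>T\<close>, which are coprime to \<open>q\<close>.\<close>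
  have split: "A = A' \<union> (\<lambda>n. q * n) ` A"
  proof (intro equalityI subsetI)
    fix n assume n: "n \<in> A"
    show "n \<in> A' \<union> (\<lambda>n. q * n) ` A"
    proof (cases "q dvd n")
      case True
      then obtain k where k: "n = q * k" by (elim dvdE)
      then have "k \<in> A" using n by (auto simp: A_def)
      then show ?thesis using k by blast
    qed (use n in \<open>auto simp: A_def A'_def\<close>)
  next
    fix n assume "n \<in> A' \<union> (\<lambda>n. q * n) ` A"
    then show "n \<in> A"
      using q0 cop by (auto simp: A_def A'_def coprime_dvd_mult_right_iff)
  qed
  have disj: "A' \<inter> (\<lambda>n. q * n) ` A = {}" by (auto simp: A'_def)
  have inj: "inj_on (\<lambda>n. q * n) A" using q0 by (auto simp: inj_on_def)
  have "infsum f A = infsum f A' + infsum f ((\<lambda>n. q * n) ` A)"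
    unfolding split[THEN arg_cong[where f = "infsum f"]]
    by (rule infsum_Un_disjoint[OF _ _ disj]) (rule summ'; use q0 in \<open>auto simp: A_def A'_def Suc_le_eq\<close>)+
  moreover have "infsum f ((\<lambda>n. q * n) ` A) = f q * infsum f A"
    unfolding infsum_reindex[OF inj] o_def mult by (rule infsum_cmult_right')
  ultimately have "infsum f A' = infsum f A - f q * infsum f A" by linarith
  also have "\<dots> = infsum f A * (1 - f q)" by (simp add: right_diff_distrib)
  finally have "infsum f A' = infsum f A * (1 - f q)" .
  then show ?case using insert by (simp add: A_def A'_def ac_simps)
qed

text \<open>Taking logarithms in the Euler product gives the sum of \<open>f\<close> over the
  primes, up to the quadratic error of \<open>ln (1 - f p)\<close>. The error depends on
  \<open>f\<close> only through the bound \<open>C\<close> on sums of squares, so it stays uniform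
  in \<open>s\<close> when \<open>f n = \<psi> n * n powr - s\<close>.\<close>

lemma ln_infsum_completely_multiplicative:
  fixes f :: "nat \<Rightarrow> real"
  assumes mult: "\<And>m n. f (m * n) = f m * f n" and one: "f 1 = 1"
    and summ: "(\<lambda>n. \<bar>f n\<bar>) summable_on {1..}"
    and half: "\<And>p. prime p \<Longrightarrow> \<bar>f p\<bar> \<le> 1 / 2"
    and sq: "\<And>T. finite T \<Longrightarrow> T \<subseteq> {p. prime p} \<Longrightarrow> (\<Sum>p\<in>T. (f p)\<^sup>2) \<le> C"
  shows "infsum f {1..} > 0"
    and "\<bar>ln (infsum f {1..}) - infsum f {p. prime p}\<bar> \<le> 2 * C"
proof -
  define L where "L = infsum f {1..}"
  define T where "T x = {p::nat. prime p \<and> p < x}" for x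
  define P where "P x = (\<Prod>p\<in>T x. 1 - f p)" for x
  have fin: "finite (T x)" for x unfolding T_def by simp
  have summ': "f summable_on B" if "B \<subseteq> {1..}" for B
    using summable_on_subset_banach[OF abs_summable_summable[of f] that] summ by simp
  have abs': "(\<lambda>n. \<bar>f n\<bar>) summable_on B" if "B \<subseteq> {1..}" for B
    by (rule summable_on_subset_banach[OF summ that])
  \<comment> \<open>By the sieve, \<open>L * P x\<close> is the sum over the numbers without a prime
    factor below \<open>x\<close>: the term \<open>f 1 = 1\<close> and a part of the tail
    \<open>n \<ge> x\<close> of an absolutely convergent series.\<close>
  have "(\<lambda>x. L * P x) \<longlonglongrightarrow> 1"
  proof (rule Lim_null[THEN iffD2], rule Lim_null_comparison)
    show "(\<lambda>x. infsum (\<lambda>n. \<bar>f n\<bar>) {1..} - (\<Sum>n | n \<in> {1..} \<and> n < x. \<bar>f n\<bar>)) \<longlonglongrightarrow> 0"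
      using tendsto_diff[OF tendsto_const infsum_nat_LIMSEQ[OF summ], of "infsum (\<lambda>n. \<bar>f n\<bar>) {1..}"] by simp
    show "\<forall>\<^sub>F x in sequentially. norm (L * P x - 1) \<le> infsum (\<lambda>n. \<bar>f n\<bar>) {1..} - (\<Sum>n | n \<in> {1..} \<and> n < x. \<bar>f n\<bar>)"
      using eventually_ge_at_top[of 2]
    proof eventually_elim
      case (elim x)
      define A where "A = {n\<in>{1::nat..}. \<forall>p\<in>T x. \<not> p dvd n}"
      have one_in: "1 \<in> A" by (auto simp: A_def T_def)
      have A: "n \<ge> x" if n: "n \<in> A - {1}" for n
      proof (rule ccontr)
        assume "\<not> n \<ge> x"
        moreover obtain p where p: "prime p" "p dvd n" using prime_factor_nat[of n] n by blast
        moreover have "p \<le> n" using p n by (auto simp: A_def dest!: dvd_imp_le)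
        ultimately show False using p n by (auto simp: A_def T_def)
      qed
      have LP: "L * P x = infsum f A"
        unfolding L_def P_def A_def by (rule infsum_sieve[OF mult summ fin, symmetric]) (auto simp: T_def)
      have "f summable_on A" by (rule summ') (auto simp: A_def)
      moreover have "f summable_on {1}" by simp
      ultimately have "infsum f (A - {1}) = infsum f A - infsum f {1}"
        by (rule infsum_Diff) (use one_in in simp)
      also have "infsum f {1} = 1" using one by simp
      finally have "norm (L * P x - 1) = norm (infsum f (A - {1}))" unfolding LP by (rule arg_cong[OF sym])
      also have "\<dots> \<le> infsum (\<lambda>n. norm (f n)) (A - {1})"
        by (rule norm_infsum_bound) (unfold real_norm_def, rule abs', auto simp: A_def)
      also have "\<dots> \<le> infsum (\<lambda>n. \<bar>f n\<bar>) ({1..} - {n. n \<in> {1..} \<and> n < x})"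
        unfolding real_norm_def
      proof (rule infsum_mono2)
        show "A - {1} \<subseteq> {1..} - {n. n \<in> {1..} \<and> n < x}" 
        proof
          fix n assume n: "n \<in> A - {1}"
          then have "n \<in> {1..}" by (simp add: A_def)
          with A[OF n] show "n \<in> {1..} - {n. n \<in> {1..} \<and> n < x}" by simp
        qed
      qed (rule abs', auto simp: A_def)+
      also have "\<dots> = infsum (\<lambda>n. \<bar>f n\<bar>) {1..} - infsum (\<lambda>n. \<bar>f n\<bar>) {n. n \<in> {1..} \<and> n < x}"
        by (rule infsum_Diff[OF summ]) (rule abs', auto)+
      also have "infsum (\<lambda>n. \<bar>f n\<bar>) {n. n \<in> {1..} \<and> n < x} = (\<Sum>n | n \<in> {1..} \<and> n < x. \<bar>f n\<bar>)"
        by (rule infsum_finite) simp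
      finally show ?case .
    qed
  qed
  note lim = this
  have factor: "1 - f p > 0" if "p \<in> T x" for p x
    using half[of p] that by (simp add: T_def abs_le_iff)
  then have pos: "P x > 0" for x unfolding P_def by (intro prod_pos) auto
  have "\<forall>\<^sub>F x in sequentially. 0 < L * P x" by (rule order_tendstoD(1)[OF lim]) simp
  from eventually_happens'[OF sequentially_bot this] obtain x where "L * P x > 0" by blast
  \<comment> \<open>Every \<open>P x\<close> is positive, so one positive value of
    \<open>L * P x\<close> fixes the sign of \<open>L\<close>.\<close>
  then show L: "infsum f {1..} > 0" using pos[of x] by (simp add: L_def zero_less_mult_iff)
  have "(\<lambda>x. ln (L * P x)) \<longlonglongrightarrow> ln 1" by (intro tendsto_ln lim) simp
  moreover have "(\<lambda>x. sum f {n\<in>{p. prime p}. n < x}) \<longlonglongrightarrow> infsum f {p. prime p}"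
    by (rule infsum_nat_LIMSEQ) (auto intro!: summ' dest: prime_gt_0_nat)
  then have "(\<lambda>x. sum f (T x)) \<longlonglongrightarrow> infsum f {p. prime p}" by (simp add: T_def)
  \<comment> \<open>The subtracted term tends to \<open>\<bar>ln 1\<bar> = 0\<close>. It absorbs the
    discrepancy between \<open>ln L\<close> and \<open>- ln (P x)\<close>, so that a bound valid for
    every \<open>x\<close> passes to the limit.\<close>
  ultimately have "(\<lambda>x. \<bar>ln L - sum f (T x)\<bar> - \<bar>ln (L * P x)\<bar>) \<longlonglongrightarrow> \<bar>ln L - infsum f {p. prime p}\<bar> - \<bar>ln 1\<bar>"
    by (intro tendsto_diff tendsto_rabs tendsto_const)
  moreover have "\<bar>ln L - sum f (T x)\<bar> - \<bar>ln (L * P x)\<bar> \<le> 2 * C" for x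
  proof -
    have "ln (P x) = (\<Sum>p\<in>T x. ln (1 - f p))" unfolding P_def
      by (rule ln_prod) (use fin factor in \<open>fastforce+\<close>)
    then have "ln (L * P x) = ln L + (\<Sum>p\<in>T x. ln (1 - f p))"
      using L pos[of x] by (simp add: ln_mult L_def)
    then have "\<bar>ln L - sum f (T x)\<bar> - \<bar>ln (L * P x)\<bar> \<le> \<bar>\<Sum>p\<in>T x. ln (1 - f p) + f p\<bar>"
      unfolding sum.distrib by linarith
    also have "\<dots> \<le> (\<Sum>p\<in>T x. 2 * (f p)\<^sup>2)"
    proof (rule order_trans[OF sum_abs sum_mono])
      fix p assume "p \<in> T x"
      then show "\<bar>ln (1 - f p) + f p\<bar> \<le> 2 * (f p)\<^sup>2"
        using abs_ln_one_plus_x_minus_x_bound[of "- f p"] half[of p] by (simp add: T_def)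
    qed
    also have "\<dots> = 2 * (\<Sum>p\<in>T x. (f p)\<^sup>2)" by (simp add: sum_distrib_left)
    also have "\<dots> \<le> 2 * C" using sq[OF fin, of x] by (auto simp: T_def)
    finally show ?thesis .
  qed
  ultimately have "\<bar>ln L - infsum f {p. prime p}\<bar> - \<bar>ln 1\<bar> \<le> 2 * C"
    by (intro LIMSEQ_le_const2) auto
  then show "\<bar>ln (infsum f {1..}) - infsum f {p. prime p}\<bar> \<le> 2 * C" by (simp add: L_def)
qed

text \<open>Summation by parts: the partial sums of \<open>a\<close> are at most \<open>K\<close> in
  absolute value, and the decrements of \<open>b\<close> are nonnegative and telescope to
  \<open>b m - b n\<close>.\<close>

lemma abel_summation_bound:
  fixes a b :: "nat \<Rightarrow> real"
  assumes K: "\<And>j. j \<ge> m \<Longrightarrow> \<bar>\<Sum>k=m..<j. a k\<bar> \<le> K"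
    and decr: "\<And>k. k \<ge> m \<Longrightarrow> b (Suc k) \<le> b k" and nonneg: "\<And>k. k \<ge> m \<Longrightarrow> b k \<ge> 0" and "m \<le> n"
  shows "\<bar>\<Sum>k=m..<n. a k * b k\<bar> \<le> K * b m"
proof -
  define S where "S j = (\<Sum>k=m..<j. a k)" for j
  have S: "\<bar>S j\<bar> \<le> K" if "j \<ge> m" for j using K[OF that] by (simp add: S_def)
  have "(\<Sum>k=m..<n. a k * b k) = S n * b n + (\<Sum>k=m..<n. S (Suc k) * (b k - b (Suc k)))"
    using \<open>m \<le> n\<close> by (induction n rule: dec_induct) (simp_all add: S_def algebra_simps)
  also have "\<bar>\<dots>\<bar> \<le> K * b n + (\<Sum>k=m..<n. K * (b k - b (Suc k)))"
  proof (intro order_trans[OF abs_triangle_ineq] add_mono order_trans[OF sum_abs] sum_mono)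
    show "\<bar>S n * b n\<bar> \<le> K * b n"
      using S[OF \<open>m \<le> n\<close>] nonneg[OF \<open>m \<le> n\<close>] by (simp add: abs_mult mult_right_mono)
    fix k assume "k \<in> {m..<n}"
    then show "\<bar>S (Suc k) * (b k - b (Suc k))\<bar> \<le> K * (b k - b (Suc k))"
      using S[of "Suc k"] decr[of k] by (simp add: abs_mult mult_right_mono)
  qed
  also have "(\<Sum>k=m..<n. K * (b k - b (Suc k))) = K * (b m - b n)"
    using \<open>m \<le> n\<close> by (induction n rule: dec_induct) (simp_all add: algebra_simps)
  finally show ?thesis by (simp add: algebra_simps)
qed

subsection \<open>Real characters and the nonvanishing of L(1)\<close>

text \<open>Unique factorisation behind the multiplicativity of divisor sums; the exponent
  \<open>i\<close> is recovered from \<open>p ^ i * d\<close> as the multiplicity of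
  \<open>p\<close>.\<close>

lemma dvd_prime_power_mult_bij:
  fixes p m :: nat
  assumes p: "prime p" and m: "\<not> p dvd m"
  shows "bij_betw (\<lambda>(i, d). p ^ i * d) ({..a} \<times> {d. d dvd m}) {d. d dvd p ^ a * m}"
proof (rule bij_betwI')
  fix x y assume "x \<in> {..a} \<times> {d. d dvd m}" "y \<in> {..a} \<times> {d. d dvd m}"
  then obtain i d j e where x: "x = (i, d)" "d dvd m" and y: "y = (j, e)" "e dvd m" by auto
  have d: "\<not> p dvd d" "\<not> p dvd e" using m x y dvd_trans by blast+
  have "multiplicity p (p ^ i * d) = i" "multiplicity p (p ^ j * e) = j"
    using prime_gt_0_nat[OF p] d by (auto intro!: multiplicity_eqI simp: mult.commute[of p])
  then have "i = j" if "p ^ i * d = p ^ j * e" using that by simp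
  then show "(case x of (i, d) \<Rightarrow> p ^ i * d) = (case y of (i, d) \<Rightarrow> p ^ i * d) \<longleftrightarrow> x = y"
    using p by (auto simp: x y dest: prime_gt_0_nat)
next
  fix x assume "x \<in> {..a} \<times> {d. d dvd m}"
  then show "(case x of (i, d) \<Rightarrow> p ^ i * d) \<in> {d. d dvd p ^ a * m}"
    by (auto intro!: mult_dvd_mono le_imp_power_dvd)
next
  fix y assume "y \<in> {d. d dvd p ^ a * m}"
  then obtain b d where "y = b * d" "b dvd p ^ a" "d dvd m" using division_decomp by blast
  moreover obtain i where "i \<le> a" "b = p ^ i" using \<open>b dvd p ^ a\<close> p by (auto simp: divides_primepow_nat)
  ultimately show "\<exists>x\<in>{..a} \<times> {d. d dvd m}. y = (case x of (i, d) \<Rightarrow> p ^ i * d)" by force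
qed

text \<open>The induction step for values of multiplicative functions: peel off the full power of
  one prime and continue with the smaller cofactor.\<close>

lemma split_off_prime_power:
  fixes n :: nat
  assumes "n > 1"
  obtains p a m where "prime p" "n = p ^ a * m" "\<not> p dvd m" "m < n" "m > 0"
proof -
  obtain p where p: "prime p" "p dvd n" using prime_factor_nat[of n] assms by auto
  have "\<not> is_unit p" using p(1) not_prime_unit by blast
  then obtain m where m: "n = p ^ multiplicity p n * m" "\<not> p dvd m"
    using multiplicity_decompose'[of n p] assms by auto
  have "multiplicity p n > 0" using p assms by (simp add: prime_multiplicity_gt_zero_iff)
  then have "p ^ multiplicity p n > 1" using prime_gt_1_nat[OF p(1)] by (rule one_less_power[rotated])
  moreover have m0: "m > 0" using m assms by (metis gr0I mult_0_right not_less_zero)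
  ultimately have "1 * m < p ^ multiplicity p n * m" by (rule mult_strict_right_mono)
  then have "m < n" using m(1) by simp
  with that p m m0 show ?thesis by blast
qed

text \<open>Nontriviality is kept out, so that the constant function 1 is an instance too and yields
  the zeta function.\<close>

locale real_character =
  fixes \<psi> :: "nat \<Rightarrow> real"
  assumes mult: "\<psi> (m * n) = \<psi> m * \<psi> n"
    and one: "\<psi> 1 = 1"
    and vals: "\<psi> n \<in> {-1, 0, 1}"
begin

lemma abs_le_1: "\<bar>\<psi> n\<bar> \<le> 1"
  using vals[of n] by auto

lemma power: "\<psi> (m ^ k) = \<psi> m ^ k"
  using one by (induction k) (auto simp: mult)

lemma sum_divisors_prime_power_mult:
  assumes "prime p" "\<not> p dvd m"
  shows "(\<Sum>d | d dvd p ^ a * m. \<psi> d) = (\<Sum>i\<le>a. \<psi> p ^ i) * (\<Sum>d | d dvd m. \<psi> d)"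
proof -
  have "(\<Sum>d | d dvd p ^ a * m. \<psi> d) = (\<Sum>(i, d)\<in>{..a} \<times> {d. d dvd m}. \<psi> (p ^ i * d))"
    using sum.reindex_bij_betw[OF dvd_prime_power_mult_bij[OF assms], of \<psi> a, symmetric]
    by (simp add: case_prod_unfold)
  also have "\<dots> = (\<Sum>i\<le>a. \<psi> p ^ i) * (\<Sum>d | d dvd m. \<psi> d)"
    by (simp add: sum_product sum.cartesian_product mult power)
  finally show ?thesis .
qed

text \<open>For \<open>\<psi> p = -1\<close> the partial sums alternate between 1 and 0, starting
  with 1 at \<open>a = 0\<close>; otherwise all terms are nonnegative and the term
  \<open>i = 0\<close> is 1.\<close>

lemma sum_powers_nonneg: "(\<Sum>i\<le>a. \<psi> p ^ i) \<ge> 0"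
  and sum_powers_even: "even a \<Longrightarrow> (\<Sum>i\<le>a. \<psi> p ^ i) \<ge> 1"
proof -
  consider "\<psi> p = -1" | "\<psi> p \<ge> 0" using vals[of p] by auto
  then have "(\<Sum>i\<le>a. \<psi> p ^ i) \<ge> 0 \<and> (even a \<longrightarrow> (\<Sum>i\<le>a. \<psi> p ^ i) \<ge> 1)"
  proof cases
    case 1
    have "(\<Sum>i\<le>a. (-1 :: real) ^ i) = (if even a then 1 else 0)" by (induction a) auto
    with 1 show ?thesis by simp
  next
    case 2
    have "(\<Sum>i\<in>{0}. \<psi> p ^ i) \<le> (\<Sum>i\<le>a. \<psi> p ^ i)" by (rule sum_mono2) (use 2 in auto)
    then show ?thesis by simp
  qed
  then show "(\<Sum>i\<le>a. \<psi> p ^ i) \<ge> 0" "even a \<Longrightarrow> (\<Sum>i\<le>a. \<psi> p ^ i) \<ge> 1" by auto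
qed

lemma sum_divisors_nonneg: "n > 0 \<Longrightarrow> (\<Sum>d | d dvd n. \<psi> d) \<ge> 0"
proof (induction n rule: less_induct)
  case (less n)
  show ?case
  proof (cases "n = 1")
    case False
    then obtain p a m where "prime p" "n = p ^ a * m" "\<not> p dvd m" "m < n" "m > 0"
      using split_off_prime_power[of n] less.prems by auto
    with less.IH[of m] show ?thesis
      by (simp add: sum_divisors_prime_power_mult sum_powers_nonneg)
  qed (use one in simp)
qed

text \<open>All prime exponents of a square are even, so each factor of the divisor sum is at least
  1.\<close>

lemma sum_divisors_square: "n > 0 \<Longrightarrow> (\<Sum>d | d dvd n\<^sup>2. \<psi> d) \<ge> 1"
proof (induction n rule: less_induct)
  case (less n)
  show ?case
  proof (cases "n = 1")
    case False
    then obtain p a m where *: "prime p" "n = p ^ a * m" "\<not> p dvd m" "m < n" "m > 0"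
      using split_off_prime_power[of n] less.prems by auto
    have "(\<Sum>d | d dvd n\<^sup>2. \<psi> d) = (\<Sum>d | d dvd p ^ (2 * a) * m\<^sup>2. \<psi> d)"
      by (simp add: *(2) power_mult_distrib power_mult[symmetric] mult.commute)
    also have "\<dots> = (\<Sum>i\<le>2 * a. \<psi> p ^ i) * (\<Sum>d | d dvd m\<^sup>2. \<psi> d)"
      using * by (intro sum_divisors_prime_power_mult) (auto dest: prime_dvd_power)
    also have "\<dots> \<ge> 1 * 1"
      by (intro mult_mono sum_powers_even sum_powers_nonneg less.IH *) auto
    finally show ?thesis by simp
  qed (use one in simp)
qed

end

section \<open>Monsky's weights\<close>

context
  fixes t :: real
  assumes t: "0 < t" "t < 1"
begin

text \<open>AM-GM for the pair \<open>t ^ i\<close> and \<open>t ^ (n - 1 - i)\<close>, whose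
  geometric mean is \<open>sqrt t ^ (n - 1)\<close> for every \<open>i\<close>.\<close>

lemma geometric_sum_ge: "(\<Sum>i<n. t ^ i) \<ge> n * sqrt t ^ (n - 1)"
proof -
  define u where "u = sqrt t"
  have u: "u > 0" "u\<^sup>2 = t" using t by (auto simp: u_def)
  have "2 * (n * u ^ (n - 1)) = (\<Sum>i<n. 2 * u ^ (n - 1))" by simp
  also have "\<dots> \<le> (\<Sum>i<n. t ^ i + t ^ (n - Suc i))"
  proof (rule sum_mono)
    fix i assume i: "i \<in> {..<n}"
    have "u ^ (n - 1) = u ^ i * u ^ (n - Suc i)" using i by (simp add: power_add[symmetric])
    moreover have "2 * (u ^ i * u ^ (n - Suc i)) \<le> (u ^ i)\<^sup>2 + (u ^ (n - Suc i))\<^sup>2"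
      using sum_squares_bound[of "u ^ i" "u ^ (n - Suc i)"] by (simp add: mult.assoc)
    moreover have "(u ^ k)\<^sup>2 = t ^ k" for k
      unfolding u(2)[symmetric] by (simp flip: power_mult add: mult.commute)
    ultimately show "2 * u ^ (n - 1) \<le> t ^ i + t ^ (n - Suc i)" by simp
  qed
  also have "\<dots> = 2 * (\<Sum>i<n. t ^ i)"
    unfolding sum.distrib using sum.nat_diff_reindex[of "\<lambda>i. t ^ i" n] by simp
  finally show ?thesis by (simp add: u_def)
qed

text \<open>The coefficient of \<open>\<psi> n\<close> in the difference between
  \<open>L(1, \<psi>) / (1 - t)\<close> and the Lambert series of \<open>\<psi>\<close>. Its value
  at 1 is 1 for every \<open>t\<close>, so Abel summation gives a bound that does not depend on
  \<open>t\<close>.\<close>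

definition monsky_weight :: "nat \<Rightarrow> real" where
  "monsky_weight n = 1 / (n * (1 - t)) - t ^ n / (1 - t ^ n)"

lemma monsky_weight_eq:
  assumes "n > 0"
  shows "(1 - t) * monsky_weight n = 1 / n - t ^ n / (\<Sum>i<n. t ^ i)"
proof -
  have "1 - t ^ n = (1 - t) * (\<Sum>i<n. t ^ i)"
    by (simp add: one_diff_power_eq)
  then show ?thesis using t by (simp add: monsky_weight_def right_diff_distrib[of "1 - t"])
qed

lemma geometric_sum_pos: "n > 0 \<Longrightarrow> (\<Sum>i<n. t ^ i) > 0"
  using t by (intro sum_pos) auto

lemma monsky_weight_nonneg:
  assumes "n > 0"
  shows "monsky_weight n \<ge> 0"
proof -
  have "n * t ^ n = (\<Sum>i<n. t ^ n)" by simp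
  also have "\<dots> \<le> (\<Sum>i<n. t ^ i)" by (rule sum_mono) (use t in \<open>auto intro!: power_decreasing\<close>)
  finally have "t ^ n / (\<Sum>i<n. t ^ i) \<le> 1 / n"
    using assms geometric_sum_pos[OF assms] by (simp add: field_simps)
  then have "(1 - t) * monsky_weight n \<ge> 0" using monsky_weight_eq[OF assms] by simp
  then show ?thesis using t by (simp add: zero_le_mult_iff)
qed

text \<open>After multiplication by \<open>1 - t\<close> the decrements of the two parts are
  \<open>1 / (n * (n + 1))\<close> and \<open>t ^ n / (G n * G (Suc n))\<close>. The AM-GM bound on
  both geometric sums shows that the first is at least as large as the second.\<close>

lemma monsky_weight_decreasing:
  assumes "n > 0"
  shows "monsky_weight (Suc n) \<le> monsky_weight n"
proof -
  define G where "G n = (\<Sum>i<n. t ^ i)" for n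
  define u where "u = sqrt t"
  have u: "0 < u" "u \<le> 1" "u\<^sup>2 = t" using t by (auto simp: u_def)
  have pos: "G n > 0" "G (Suc n) > 0" using geometric_sum_pos[of n] geometric_sum_pos[of "Suc n"] assms by (auto simp: G_def)
  have Suc: "G (Suc n) = 1 + t * G n"
    by (simp only: G_def sum.lessThan_Suc_shift) (simp add: sum_distrib_left)
  have "(real n * u ^ (n - 1)) * (real (Suc n) * u ^ n) \<le> G n * G (Suc n)"
    unfolding G_def u_def using geometric_sum_ge[of n] geometric_sum_ge[of "Suc n"] u pos
    by (intro mult_mono) (auto simp: u_def G_def)
  \<comment> \<open>The exponents of \<open>u\<close> on the two sides are \<open>2 * n\<close> and
    \<open>2 * n - 1\<close>, and \<open>u \<le> 1\<close>.\<close>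
  moreover have "t ^ n \<le> u ^ (n - 1) * u ^ n"
    unfolding u(3)[symmetric] power_mult[symmetric] power_add[symmetric]
    by (rule power_decreasing) (use u in auto)
  then have "real n * real (Suc n) * t ^ n \<le> real n * real (Suc n) * (u ^ (n - 1) * u ^ n)"
    by (rule mult_left_mono) simp
  ultimately have "real n * real (Suc n) * t ^ n \<le> G n * G (Suc n)" by (simp add: ac_simps)
  then have "t ^ n / (G n * G (Suc n)) \<le> 1 / (real n * real (Suc n))"
    using frac_le[of "t ^ n" "t ^ n"] pos assms by (simp add: divide_le_eq le_divide_eq ac_simps)
  moreover have "t ^ n / (G n * G (Suc n)) = t ^ n / G n - t ^ Suc n / G (Suc n)"
    using pos by (simp add: field_simps Suc)
  moreover have "1 / (real n * real (Suc n)) = 1 / n - 1 / Suc n"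
    using assms by (simp add: field_simps)
  ultimately have "(1 - t) * monsky_weight (Suc n) \<le> (1 - t) * monsky_weight n"
    using assms by (simp add: monsky_weight_eq G_def)
  then show ?thesis using t by simp
qed

end

text \<open>Boundedness of the partial sums excludes the constant character 1 and is the input for
  Abel summation.\<close>

locale bounded_character = real_character +
  fixes K :: real
  assumes partial_sum_bound: "\<bar>\<Sum>n<x. \<psi> n\<bar> \<le> K"
begin

lemma K_nonneg: "K \<ge> 0"
  using partial_sum_bound[of 0] by simp

lemma interval_sum_bound: "\<bar>\<Sum>k=m..<n. \<psi> k\<bar> \<le> 2 * K"
proof (cases "m \<le> n")
  case True
  have "(\<Sum>k=m..<n. \<psi> k) = (\<Sum>k<n. \<psi> k) - (\<Sum>k<m. \<psi> k)"
    using sum_diff_nat_ivl[of 0 m n \<psi>] True by (simp add: atLeast0LessThan)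
  then show ?thesis using partial_sum_bound[of m] partial_sum_bound[of n] by linarith
qed (use K_nonneg in simp)

text \<open>Expanding the Lambert series into powers and collecting \<open>t ^ n\<close> over
  \<open>n = k * j\<close> produces the divisor sums. Truncating at \<open>N\<close> costs, for each
  \<open>k\<close>, a geometric tail of at most \<open>t ^ N / (1 - t)\<close>.\<close>

lemma lambert_sum_ge:
  fixes t :: real
  assumes t: "0 < t" "t < 1"
  shows "(\<Sum>k=1..<N. \<psi> k * (t ^ k / (1 - t ^ k))) \<ge> (\<Sum>n=1..<N. (\<Sum>d | d dvd n. \<psi> d) * t ^ n) - N * t ^ N / (1 - t)"
proof -
  have "(\<Sum>n=1..<N. (\<Sum>d | d dvd n. \<psi> d) * t ^ n) = (\<Sum>(n, d)\<in>(SIGMA n:{1..<N}. {d. d dvd n}). \<psi> d * t ^ n)"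
    unfolding sum_distrib_right by (rule sum.Sigma) auto
  also have "\<dots> = (\<Sum>(k, j)\<in>(SIGMA k:{1..<N}. {1..(N - 1) div k}). \<psi> k * t ^ (k * j))"
  proof (rule sum.reindex_bij_witness[where j = "\<lambda>(n, d). (d, n div d)" and i = "\<lambda>(k, j). (k * j, k)"])
    fix x assume "x \<in> (SIGMA n:{1..<N}. {d. d dvd n})"
    then show "(case x of (n, d) \<Rightarrow> (d, n div d)) \<in> (SIGMA k:{1..<N}. {1..(N - 1) div k})"
      by (auto simp: less_eq_div_iff_mult_less_eq Suc_le_eq div_greater_zero_iff dvd_pos_nat
          intro: div_le_mono dvd_imp_le le_less_trans[OF dvd_imp_le])
  next
    fix x assume "x \<in> (SIGMA k:{1..<N}. {1..(N - 1) div k})"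
    then show "(case x of (k, j) \<Rightarrow> (k * j, k)) \<in> (SIGMA n:{1..<N}. {d. d dvd n})"
      by (auto simp: less_eq_div_iff_mult_less_eq Suc_le_eq mult.commute)
  qed auto
  also have "\<dots> = (\<Sum>k=1..<N. \<Sum>j=1..(N - 1) div k. \<psi> k * t ^ (k * j))"
    by (rule sum.Sigma[symmetric]) auto
  also have "\<dots> \<le> (\<Sum>k=1..<N. \<psi> k * (t ^ k / (1 - t ^ k)) + t ^ N / (1 - t))"
  proof (rule sum_mono)
    fix k assume k: "k \<in> {1..<N}"
    define J where "J = (N - 1) div k"
    have tk: "t ^ k < 1" "t ^ k \<le> t" "t ^ k > 0"
      using t k power_decreasing[of 1 k t] by auto
    have "(\<Sum>j=1..J. \<psi> k * t ^ (k * j)) = \<psi> k * (\<Sum>j=1..J. (t ^ k) ^ j)"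
      by (simp add: sum_distrib_left power_mult)
    also have "(\<Sum>j=1..J. (t ^ k) ^ j) = t ^ k / (1 - t ^ k) - t ^ (k * Suc J) / (1 - t ^ k)"
    proof -
      have "(\<Sum>j=1..J. y ^ j) = y / (1 - y) - y ^ Suc J / (1 - y)" if "y < 1" for y :: real
        
      proof -
        have "(1 - y) * (\<Sum>j=1..J. y ^ j) = y - y ^ Suc J" 
          by (induction J) (simp_all add: distrib_left, simp add: algebra_simps)
        then show ?thesis using that by (simp add: eq_divide_eq mult.commute flip: diff_divide_distrib)
      qed
      from this[OF tk(1)] show ?thesis by (simp only: power_mult)
    qed
    finally have "(\<Sum>j=1..J. \<psi> k * t ^ (k * j)) = \<psi> k * (t ^ k / (1 - t ^ k)) - \<psi> k * (t ^ (k * Suc J) / (1 - t ^ k))"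
      by (simp add: algebra_simps)
    moreover have "- \<psi> k * (t ^ (k * Suc J) / (1 - t ^ k)) \<le> 1 * (t ^ (k * Suc J) / (1 - t ^ k))"
      using abs_le_1[of k] tk t by (intro mult_right_mono) auto
    \<comment> \<open>The first exponent missing from the truncated inner series is
      \<open>k * Suc J\<close>, which is at least \<open>N\<close> by the choice of
      \<open>J\<close>; and \<open>t ^ k \<le> t\<close> bounds the denominator.\<close>
    moreover have "t ^ (k * Suc J) / (1 - t ^ k) \<le> t ^ N / (1 - t)"
    proof (rule frac_le)
      have "N - 1 < k * Suc J" using k dividend_less_times_div[of k "N - 1"] by (simp add: J_def)
      then show "t ^ (k * Suc J) \<le> t ^ N" using t by (intro power_decreasing) auto
    qed (use t tk in auto)
    ultimately show "(\<Sum>j=1..(N - 1) div k. \<psi> k * t ^ (k * j)) \<le> \<psi> k * (t ^ k / (1 - t ^ k)) + t ^ N / (1 - t)"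
      unfolding J_def by linarith
  qed
  also have "\<dots> = (\<Sum>k=1..<N. \<psi> k * (t ^ k / (1 - t ^ k))) + (N - 1) * (t ^ N / (1 - t))"
    by (simp add: sum.distrib)
  also have "(N - 1) * (t ^ N / (1 - t)) \<le> N * (t ^ N / (1 - t))"
    by (rule mult_right_mono) (use t in auto)
  finally show ?thesis by simp
qed

text \<open>
  This is Monsky's argument: if \<open>L(1, \<psi>) = 0\<close>, then Abel summation bounds the Lambert
  series of \<open>\<psi>\<close>, whose coefficients are nonnegative and at least 1 at the squares.
\<close>
lemma L_one_nonzero: "\<not> (\<lambda>N. \<Sum>k=1..<N. \<psi> k / k) \<longlonglongrightarrow> 0"
proof
  assume lim: "(\<lambda>N. \<Sum>k=1..<N. \<psi> k / k) \<longlonglongrightarrow> 0"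
  \<comment> \<open>The bound is uniform in both \<open>t\<close> and \<open>M\<close>, as the limit
    \<open>t \<rightarrow> 1\<close> below requires.\<close>
  have bound: "(\<Sum>m=1..M. t ^ m\<^sup>2) \<le> 2 * K" if t: "0 < t" "t < 1" for t :: real and M :: nat
  proof -
    \<comment> \<open>For fixed \<open>t\<close>, the partial sums of \<open>L(1, \<psi>)\<close>
      tend to 0 by assumption and the truncation error of the Lambert series tends to 0 as well,
      which leaves \<open>2 * K\<close>.\<close>
    have "(\<lambda>N. (\<Sum>k=1..<N. \<psi> k / k) / (1 - t) + 2 * K + N * t ^ N / (1 - t)) \<longlonglongrightarrow> 0 / (1 - t) + 2 * K + 0 / (1 - t)"
      by (intro tendsto_intros lim powser_times_n_limit_0) (use t in auto)
    moreover have "\<forall>\<^sub>F N in sequentially. (\<Sum>m=1..M. t ^ m\<^sup>2) \<le> (\<Sum>k=1..<N. \<psi> k / k) / (1 - t) + 2 * K + N * t ^ N / (1 - t)"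
      using eventually_gt_at_top[of "M\<^sup>2 + 1"]
    proof eventually_elim
      case (elim N)
      have "\<bar>\<Sum>k=1..<N. \<psi> k * monsky_weight t k\<bar> \<le> 2 * K * monsky_weight t 1"
        using t elim interval_sum_bound
        by (intro abel_summation_bound) (auto intro: monsky_weight_decreasing monsky_weight_nonneg)
      also have "monsky_weight t 1 = 1" using t by (simp add: monsky_weight_def diff_divide_distrib[symmetric])
      finally have "\<bar>\<Sum>k=1..<N. \<psi> k * monsky_weight t k\<bar> \<le> 2 * K" by simp
      moreover have "(\<Sum>k=1..<N. \<psi> k * monsky_weight t k) =
          (\<Sum>k=1..<N. \<psi> k / k) / (1 - t) - (\<Sum>k=1..<N. \<psi> k * (t ^ k / (1 - t ^ k)))"
        using t by (simp add: monsky_weight_def right_diff_distrib sum_subtractf sum_divide_distrib)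
      moreover note lambert_sum_ge[OF t, of N]
      moreover have "(\<Sum>m=1..M. t ^ m\<^sup>2) \<le> (\<Sum>n=1..<N. (\<Sum>d | d dvd n. \<psi> d) * t ^ n)"
      proof -
        have inj: "inj_on (\<lambda>m. m\<^sup>2) {1..M}" by (auto simp: inj_on_def power2_eq_iff_nonneg)
        have "(\<Sum>m=1..M. t ^ m\<^sup>2) \<le> (\<Sum>m=1..M. (\<Sum>d | d dvd m\<^sup>2. \<psi> d) * t ^ m\<^sup>2)"
          by (rule sum_mono) (use t sum_divisors_square in auto)
        also have "\<dots> = (\<Sum>n\<in>(\<lambda>m. m\<^sup>2) ` {1..M}. (\<Sum>d | d dvd n. \<psi> d) * t ^ n)"
          using inj by (simp add: sum.reindex)
        also have "\<dots> \<le> (\<Sum>n=1..<N. (\<Sum>d | d dvd n. \<psi> d) * t ^ n)"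
        proof (rule sum_mono2)
          show "(\<lambda>m. m\<^sup>2) ` {1..M} \<subseteq> {1..<N}"
          proof
            fix n assume "n \<in> (\<lambda>m. m\<^sup>2) ` {1..M}"
            then obtain m where m: "n = m\<^sup>2" "1 \<le> m" "m \<le> M" by auto
            then have "m\<^sup>2 \<le> M\<^sup>2" by (intro power_mono) auto
            then have "m\<^sup>2 < N" using elim by linarith
            then show "n \<in> {1..<N}" using m by (simp add: Suc_le_eq)
          qed
        qed (use t in \<open>auto intro!: mult_nonneg_nonneg sum_divisors_nonneg\<close>)
        finally show ?thesis .
      qed
      ultimately show ?case by linarith
    qed
    ultimately have "(\<Sum>m=1..M. t ^ m\<^sup>2) \<le> 0 / (1 - t) + 2 * K + 0 / (1 - t)"
      by (rule tendsto_lowerbound) simp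
    then show ?thesis by simp
  qed
  \<comment> \<open>As \<open>t \<rightarrow> 1\<close> from below, the finite sum over squares
    tends to \<open>M\<close>, so the uniform bound would hold for every natural number
    \<open>M\<close>.\<close>
  have "real M \<le> 2 * K" for M :: nat
  proof -
    have "((\<lambda>t::real. \<Sum>m=1..M. t ^ m\<^sup>2) \<longlongrightarrow> (\<Sum>m=1..M. 1 ^ m\<^sup>2)) (at_left 1)"
      by (intro tendsto_intros)
    moreover have "\<forall>\<^sub>F t in at_left (1::real). (\<Sum>m=1..M. t ^ m\<^sup>2) \<le> 2 * K"
    proof (rule eventually_mono)
      show "\<forall>\<^sub>F t in at_left (1::real). t \<in> {0<..<1}" by (rule eventually_at_left_real) simp
    qed (intro bound; simp)
    ultimately have "(\<Sum>m=1..M. (1::real) ^ m\<^sup>2) \<le> 2 * K"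
      by (rule tendsto_upperbound) simp
    then show ?thesis by simp
  qed
  moreover obtain M :: nat where "2 * K < real M" using reals_Archimedean2 by blast
  ultimately show False using not_le by blast
qed

end

subsection \<open>Sums of a real character over the primes\<close>

definition prime_sum :: "(nat \<Rightarrow> real) \<Rightarrow> real \<Rightarrow> real" where
  "prime_sum f s = infsum (\<lambda>p. f p * p powr - s) {p. prime p}"

text \<open>This is zeta(2); the summand at \<open>n = 0\<close> vanishes because
  \<open>inverse 0 = 0\<close>.\<close>

definition sum_inverse_squares :: real where
  "sum_inverse_squares = (\<Sum>n. inverse (real n ^ 2))"

context real_character
begin

lemma abs_summable_dirichlet:
  assumes "s > 1"
  shows "(\<lambda>n. \<bar>\<psi> n * n powr - s\<bar>) summable_on A"
proof (rule summable_on_subset_banach)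
  have "summable (\<lambda>n. real n powr - s)" using assms by (simp add: summable_real_powr_iff)
  then have "summable (\<lambda>n. norm \<bar>\<psi> n * n powr - s\<bar>)"
    by (rule summable_comparison_test'[where N = 0])
       (use abs_le_1 in \<open>simp add: abs_mult mult_left_le_one_le\<close>)
  then show "(\<lambda>n. \<bar>\<psi> n * n powr - s\<bar>) summable_on UNIV" by (rule norm_summable_imp_summable_on)
qed simp

lemma summable_dirichlet:
  assumes "s > 1"
  shows "(\<lambda>n. \<psi> n * n powr - s) summable_on A"
  using abs_summable_summable[of "\<lambda>n. \<psi> n * n powr - s"] abs_summable_dirichlet[OF assms] by simp

text \<open>The bound \<open>\<bar>f n\<bar> \<le> 1 / n\<close> holds for all \<open>s > 1\<close>
  at once; it gives both the bound 1/2 at primes and an error constant independent of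
  \<open>s\<close>.\<close>

lemma dirichlet_pos: "s > 1 \<Longrightarrow> infsum (\<lambda>n. \<psi> n * n powr - s) {1..} > 0"
  and ln_dirichlet: "s > 1 \<Longrightarrow> \<bar>ln (infsum (\<lambda>n. \<psi> n * n powr - s) {1..}) - prime_sum \<psi> s\<bar> \<le> 2 * sum_inverse_squares"
proof -
  assume s: "s > 1"
  define f where "f = (\<lambda>n. \<psi> n * real n powr - s)"
  have bound: "\<bar>f n\<bar> \<le> 1 / n" if "n > 0" for n
  proof -
    have "\<bar>f n\<bar> \<le> 1 * n powr - s"
      unfolding f_def abs_mult by (rule mult_mono) (use abs_le_1 in auto)
    also have "1 * real n powr - s \<le> n powr - 1" unfolding mult_1 by (rule powr_mono) (use that s in auto)
    also have "\<dots> = 1 / n" using that by (simp add: powr_minus_divide)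
    finally show ?thesis .
  qed
  have mult': "f (m * n) = f m * f n" for m n by (simp add: f_def mult powr_mult ac_simps)
  have one': "f 1 = 1" by (simp add: f_def one[simplified])
  have half: "\<bar>f p\<bar> \<le> 1 / 2" if "prime p" for p
  proof -
    have "\<bar>f p\<bar> \<le> 1 / p" using bound prime_gt_0_nat[OF that] by simp
    also have "\<dots> \<le> 1 / 2" using prime_ge_2_nat[OF that] by (simp add: field_simps)
    finally show ?thesis .
  qed
  have sq: "(\<Sum>p\<in>T. (f p)\<^sup>2) \<le> sum_inverse_squares" if T: "finite T" "T \<subseteq> {p. prime p}" for T
  proof -
    have "(\<Sum>p\<in>T. (f p)\<^sup>2) \<le> (\<Sum>p\<in>T. inverse (real p ^ 2))"
    proof (rule sum_mono)
      fix p assume "p \<in> T"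
      then have "\<bar>f p\<bar> \<le> 1 / p" using bound T prime_gt_0_nat by blast
      then have "\<bar>f p\<bar>\<^sup>2 \<le> (1 / p)\<^sup>2" by (rule power_mono) simp
      then show "(f p)\<^sup>2 \<le> inverse (real p ^ 2)" by (simp add: power_divide divide_inverse power_inverse)
    qed
    also have "\<dots> \<le> sum_inverse_squares" unfolding sum_inverse_squares_def
      by (rule sum_le_suminf) (use T inverse_power_summable[of 2, where 'a = real] in auto)
    finally show ?thesis .
  qed
  note * = ln_infsum_completely_multiplicative[OF mult' one' _ half sq]
  show "infsum (\<lambda>n. \<psi> n * n powr - s) {1..} > 0"
    using *(1) abs_summable_dirichlet[OF s] unfolding f_def by simp
  show "\<bar>ln (infsum (\<lambda>n. \<psi> n * n powr - s) {1..}) - prime_sum \<psi> s\<bar> \<le> 2 * sum_inverse_squares"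
    using *(2) abs_summable_dirichlet[OF s] unfolding f_def prime_sum_def by simp
qed

end

section \<open>The L-function on the closed interval from 1 to 2\<close>

context bounded_character
begin

definition L_partial :: "nat \<Rightarrow> real \<Rightarrow> real" where
  "L_partial N s = (\<Sum>k=1..<N. \<psi> k * k powr - s)"

definition L :: "real \<Rightarrow> real" where
  "L s = lim (\<lambda>N. L_partial N s)"

lemma L_partial_diff:
  assumes "1 \<le> m" "m \<le> n" "s > 0"
  shows "\<bar>L_partial n s - L_partial m s\<bar> \<le> 2 * K * m powr - s"
proof -
  have "L_partial n s - L_partial m s = (\<Sum>k=m..<n. \<psi> k * k powr - s)"
    unfolding L_partial_def using assms by (simp add: sum_diff_nat_ivl)
  also have "\<bar>\<dots>\<bar> \<le> 2 * K * m powr - s"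
    by (rule abel_summation_bound) (use assms interval_sum_bound in \<open>auto intro!: powr_mono2'\<close>)
  finally show ?thesis .
qed

text \<open>Abel summation bounds the tail by \<open>2 * K * m powr - s\<close>, hence by
  \<open>2 * K / m\<close> for all \<open>s \<ge> 1\<close>. Uniformity up to the endpoint gives
  continuity of \<open>L\<close> at 1, the link between \<open>s > 1\<close> and
  \<open>s = 1\<close>.\<close>

lemma uniform_limit_L: "uniform_limit {1..2} L_partial L sequentially"
  unfolding L_def uniformly_convergent_uniform_limit_iff[symmetric]
proof (intro Cauchy_uniformly_convergent uniformly_Cauchy_onI')
  fix e :: real assume e: "e > 0"
  obtain M :: nat where M: "2 * K / e < real M" using reals_Archimedean2 by blast
  then have M0: "M > 0" using e K_nonneg by (metis divide_nonneg_pos gr0I not_less of_nat_0 mult_nonneg_nonneg zero_le_numeral)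
  have "dist (L_partial m s) (L_partial n s) < e" if "s \<in> {1..2}" "m \<ge> M" "n > m" for s m n
  proof -
    have "dist (L_partial m s) (L_partial n s) \<le> 2 * K * m powr - s"
      using L_partial_diff[of m n s] that M0 by (simp add: dist_real_def abs_minus_commute)
    also have "\<dots> \<le> 2 * K * m powr - 1"
      using that M0 K_nonneg by (intro mult_left_mono powr_mono) auto
    also have "\<dots> = 2 * K / m" using that M0 by (simp add: powr_minus_divide)
    also have "\<dots> \<le> 2 * K / M" using that M0 K_nonneg by (intro divide_left_mono) auto
    also have "\<dots> < e" using M M0 e by (simp add: field_simps)
    finally show ?thesis .
  qed
  then show "\<exists>M. \<forall>s\<in>{1..2}. \<forall>m\<ge>M. \<forall>n>m. dist (L_partial m s) (L_partial n s) < e" by blast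
qed

lemma L_partial_tendsto: "s \<in> {1..2} \<Longrightarrow> (\<lambda>N. L_partial N s) \<longlonglongrightarrow> L s"
  using tendsto_uniform_limitI[OF uniform_limit_L] .

lemma continuous_on_L: "continuous_on {1..2} L"
  by (rule uniform_limit_theorem[OF _ uniform_limit_L])
     (auto simp: L_partial_def intro!: always_eventually continuous_intros)

lemma L_le:
  assumes s: "s \<in> {1..2}"
  shows "L s \<le> 2 * K"
proof (rule tendsto_upperbound[OF L_partial_tendsto[OF s]])
  show "\<forall>\<^sub>F N in sequentially. L_partial N s \<le> 2 * K"
    using eventually_ge_at_top[of 1]
  proof eventually_elim
    case (elim N)
    have "L_partial 1 s = 0" by (simp add: L_partial_def)
    then show ?case using L_partial_diff[of 1 N s] elim s by simp
  qed
qed simp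

lemma L_eq_infsum:
  assumes s: "1 < s" "s \<le> 2"
  shows "L s = infsum (\<lambda>n. \<psi> n * n powr - s) {1..}"
proof (rule LIMSEQ_unique[OF L_partial_tendsto])
  have "{n \<in> {1..}. n < x} = {1..<x}" for x :: nat by auto
  then show "(\<lambda>N. L_partial N s) \<longlonglongrightarrow> infsum (\<lambda>n. \<psi> n * n powr - s) {1..}"
    using infsum_nat_LIMSEQ[OF summable_dirichlet[OF s(1)], of "{1..}"] by (simp add: L_partial_def)
qed (use s in auto)

text \<open>For \<open>s > 1\<close> positivity is read off the Euler product; it passes to
  \<open>L 1 \<ge> 0\<close> by continuity, and Monsky's argument excludes 0.\<close>

lemma L_positive:
  assumes s: "s \<in> {1..2}"
  shows "L s > 0"
proof -
  have gt: "L s > 0" if "1 < s" "s \<le> 2" for s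
    using dirichlet_pos L_eq_infsum that by simp
  have "L 1 \<ge> 0"
  proof (rule tendsto_lowerbound)
    show "(L \<longlongrightarrow> L 1) (at 1 within {1..2})"
      using continuous_on_L by (simp add: continuous_on_def)
    show "\<forall>\<^sub>F s in at 1 within {1..2}. 0 \<le> L s"
      by (auto simp: eventually_at_filter intro!: always_eventually less_imp_le gt)
    show "at 1 within {1..2::real} \<noteq> bot"
      by (simp add: at_within_Icc_at_right)
  qed
  moreover have "L 1 \<noteq> 0"
  proof
    assume "L 1 = 0"
    then have "(\<lambda>N. L_partial N 1) \<longlonglongrightarrow> 0" using L_partial_tendsto[of 1] by simp
    moreover have "L_partial N 1 = (\<Sum>k=1..<N. \<psi> k / k)" for N
      unfolding L_partial_def by (rule sum.cong) (auto simp: powr_minus_divide)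
    ultimately show False using L_one_nonzero by simp
  qed
  ultimately show ?thesis using gt[of s] s by (cases "s = 1") auto
qed

text \<open>By compactness the positive continuous function \<open>L\<close> has a positive minimum,
  so \<open>ln L\<close> is bounded, and the prime sum differs from it by a bounded amount.\<close>

lemma prime_sum_bounded: "\<exists>C. \<forall>s. 1 < s \<and> s \<le> 2 \<longrightarrow> \<bar>prime_sum \<psi> s\<bar> \<le> C"
proof -
  obtain s0 where s0: "s0 \<in> {1..2}" "\<And>s. s \<in> {1..2} \<Longrightarrow> L s0 \<le> L s"
    using continuous_attains_inf[OF _ _ continuous_on_L] by auto
  show ?thesis
  proof (intro exI allI impI)
    fix s :: real assume s: "1 < s \<and> s \<le> 2"
    have "L s0 > 0" "L s0 \<le> L s" "L s \<le> 2 * K" using s0 s L_positive L_le by auto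
    then have "ln (L s0) \<le> ln (L s)" "ln (L s) \<le> ln (2 * K)" by auto
    moreover have "\<bar>ln (L s) - prime_sum \<psi> s\<bar> \<le> 2 * sum_inverse_squares"
      using ln_dirichlet L_eq_infsum s by simp
    ultimately show "\<bar>prime_sum \<psi> s\<bar> \<le> 2 * sum_inverse_squares + \<bar>ln (L s0)\<bar> + \<bar>ln (2 * K)\<bar>" by linarith
  qed
qed

end

interpretation trivial: real_character "\<lambda>_. 1"
  by unfold_locales auto

text \<open>The Dirichlet series of the trivial character dominates finite pieces of the harmonic
  series as \<open>s \<rightarrow> 1\<close>, so its logarithm is unbounded, and with it the prime
  sum.\<close>

lemma prime_sum_unbounded: "\<exists>s. 1 < s \<and> s \<le> 2 \<and> prime_sum (\<lambda>_. 1) s > C"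
proof -
  \<comment> \<open>Chosen so that \<open>ln C'\<close> exceeds \<open>C\<close> by exactly the
    error allowed in \<open>trivial.ln_dirichlet\<close>.\<close>
  define C' where "C' = exp (C + 2 * sum_inverse_squares)"
  have "\<not> summable (\<lambda>n. real (Suc n) powr - 1)"
    using summable_real_powr_iff[of "-1"] summable_Suc_iff[of "\<lambda>n. real n powr - 1"] by simp
  then obtain N where N: "(\<Sum>n<N. real (Suc n) powr - 1) > C'"
    using bounded_imp_summable[of "\<lambda>n. real (Suc n) powr - 1" C']
    by (metis lessThan_Suc_atMost not_le powr_ge_zero)
  have "((\<lambda>s. \<Sum>n<N. real (Suc n) powr - s) \<longlongrightarrow> (\<Sum>n<N. real (Suc n) powr - 1)) (at_right 1)"
    by (intro tendsto_intros) auto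
  from order_tendstoD(1)[OF this N]
  have "\<forall>\<^sub>F s in at_right 1. C' < (\<Sum>n<N. real (Suc n) powr - s)" .
  moreover have "\<forall>\<^sub>F s in at_right 1. s \<in> {1<..<2::real}"
    by (rule eventually_at_right_real) simp
  ultimately have "\<forall>\<^sub>F s in at_right 1. s \<in> {1<..<2::real} \<and> C' < (\<Sum>n<N. real (Suc n) powr - s)"
    by eventually_elim auto
  then obtain s where s: "1 < s" "s < 2" "C' < (\<Sum>n<N. real (Suc n) powr - s)"
    by (metis (mono_tags, lifting) eventually_happens' greaterThanLessThan_iff trivial_limit_at_right_real)
  define Z where "Z = infsum (\<lambda>n. 1 * real n powr - s) {1..}"
  have "(\<Sum>n<N. real (Suc n) powr - s) = (\<Sum>n\<in>{1..N}. 1 * real n powr - s)"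
    by (rule sum.reindex_bij_witness[of _ "\<lambda>n. n - 1" Suc]) auto
  also have "\<dots> \<le> Z" unfolding Z_def
    by (rule finite_sum_le_infsum[OF trivial.summable_dirichlet]) (use s in auto)
  finally have "C' < Z" using s by simp
  then have "ln C' < ln Z" by (subst ln_less_cancel_iff) (auto simp: C'_def intro: less_trans[OF exp_gt_zero])
  then have "C + 2 * sum_inverse_squares < ln Z" by (simp add: C'_def)
  moreover have "\<bar>ln Z - prime_sum (\<lambda>_. 1) s\<bar> \<le> 2 * sum_inverse_squares"
    unfolding Z_def using trivial.ln_dirichlet[OF s(1)] by simp
  ultimately have "prime_sum (\<lambda>_. 1) s > C" by linarith
  with s show ?thesis by (intro exI[of _ s]) auto
qed

subsection \<open>Primes with prescribed quadratic characters\<close>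

lemma has_sum_sum:
  fixes f :: "'i \<Rightarrow> 'a \<Rightarrow> real"
  assumes "finite I" "\<And>i. i \<in> I \<Longrightarrow> (f i has_sum a i) A"
  shows "((\<lambda>x. \<Sum>i\<in>I. f i x) has_sum (\<Sum>i\<in>I. a i)) A"
  using assms by (induction I rule: finite_induct) (auto intro: has_sum_add)

text \<open>
  Expanding \<open>\<Prod>i\<in>I. 1 + \<epsilon> i * \<psi> i p\<close>, which detects the primes with the prescribed values,
  leaves \<open>\<Sum>p. p powr - s\<close> plus the prime sums of nontrivial characters, which stay bounded as
  \<open>s \<rightarrow> 1\<close>.
\<close>
lemma prime_with_prescribed_characters:
  fixes \<psi> :: "'i \<Rightarrow> nat \<Rightarrow> real" and \<epsilon> :: "'i \<Rightarrow> real"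
  assumes "finite I" and char: "\<And>i. i \<in> I \<Longrightarrow> real_character (\<psi> i)"
    and sign: "\<And>i. i \<in> I \<Longrightarrow> \<epsilon> i \<in> {1, -1}"
    and bounded: "\<And>S. S \<subseteq> I \<Longrightarrow> S \<noteq> {} \<Longrightarrow> \<exists>K. bounded_character (\<lambda>n. \<Prod>i\<in>S. \<psi> i n) K"
    and fin: "finite F" and zeros: "\<And>p i. prime p \<Longrightarrow> i \<in> I \<Longrightarrow> \<psi> i p = 0 \<Longrightarrow> p \<in> F"
  shows "\<exists>p. prime p \<and> p \<notin> F \<and> (\<forall>i\<in>I. \<psi> i p = \<epsilon> i)"
proof (rule ccontr)
  assume contr: "\<nexists>p. prime p \<and> p \<notin> F \<and> (\<forall>i\<in>I. \<psi> i p = \<epsilon> i)"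
  define g where "g p = (\<Prod>i\<in>I. \<epsilon> i * \<psi> i p + 1)" for p
  define \<psi>S where "\<psi>S S = (\<lambda>n. \<Prod>i\<in>S. \<psi> i n)" for S
  define eS where "eS S = (\<Prod>i\<in>S. \<epsilon> i)" for S
  have finS: "finite S" if "S \<in> Pow I" for S using that \<open>finite I\<close> finite_subset by auto
  have abs_eS: "\<bar>eS S\<bar> = 1" if "S \<in> Pow I" for S
    unfolding eS_def abs_prod using that sign by (intro prod.neutral) fastforce
  have charS: "real_character (\<psi>S S)" if "S \<in> Pow I" for S
  proof (cases "S = {}")
    case True
    then show ?thesis by (simp add: \<psi>S_def real_character_def)
  next
    case False
    then show ?thesis using bounded[of S] that by (auto simp: \<psi>S_def bounded_character_def)
  qed
  have g_expand: "g p = (\<Sum>S\<in>Pow I. eS S * \<psi>S S p)" for p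
    unfolding g_def eS_def \<psi>S_def prod.distrib[symmetric]
    using prod_add[OF \<open>finite I\<close>, of "\<lambda>i. \<epsilon> i * \<psi> i p" "\<lambda>_. 1"] by simp
  \<comment> \<open>By the assumption for contradiction some \<open>\<psi> i p\<close> is nonzero
    and different from \<open>\<epsilon> i\<close>, hence equal to \<open>- \<epsilon> i\<close>,
    and its factor of \<open>g p\<close> vanishes.\<close>
  have g_zero: "g p = 0" if p: "prime p" "p \<notin> F" for p
  proof -
    obtain i where i: "i \<in> I" "\<psi> i p \<noteq> \<epsilon> i" using contr p by blast
    have "\<psi> i p \<in> {-1, 0, 1}" "\<psi> i p \<noteq> 0"
      using real_character.vals[OF char] zeros p i(1) by blast+
    then have "\<epsilon> i * \<psi> i p + 1 = 0" using sign[OF i(1)] i(2) by auto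
    then show ?thesis unfolding g_def using i(1) \<open>finite I\<close> by (intro prod_zero) auto
  qed
  have "\<forall>S\<in>Pow I - {{}}. \<exists>C. \<forall>s. 1 < s \<and> s \<le> 2 \<longrightarrow> \<bar>prime_sum (\<psi>S S) s\<bar> \<le> C"
    unfolding \<psi>S_def using bounded bounded_character.prime_sum_bounded by blast
  then obtain C where C: "\<And>S s. S \<in> Pow I - {{}} \<Longrightarrow> 1 < s \<Longrightarrow> s \<le> 2 \<Longrightarrow> \<bar>prime_sum (\<psi>S S) s\<bar> \<le> C S"
    by metis
  \<comment> \<open>The signed sum of all prime sums reduces to the primes in \<open>F\<close> and
    is bounded; its part for \<open>S = {}\<close> is the trivial prime sum, and every other part is
    at least \<open>- C S\<close>. Together this bounds the trivial prime sum independently of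
    \<open>s\<close>.\<close>
  have le: "prime_sum (\<lambda>_. 1) s \<le> (\<Sum>p\<in>F. \<bar>g p\<bar>) + (\<Sum>S\<in>Pow I - {{}}. C S)" if s: "1 < s" "s \<le> 2" for s
  proof -
    have "((\<lambda>p. \<Sum>S\<in>Pow I. eS S * (\<psi>S S p * p powr - s)) has_sum (\<Sum>S\<in>Pow I. eS S * prime_sum (\<psi>S S) s)) {p. prime p}"
      unfolding prime_sum_def using \<open>finite I\<close>
      by (intro has_sum_sum has_sum_cmult_right has_sum_infsum real_character.summable_dirichlet charS s) auto
    moreover have "(\<Sum>S\<in>Pow I. eS S * (\<psi>S S p * p powr - s)) = g p * p powr - s" for p
      unfolding g_expand by (simp add: sum_distrib_right mult.assoc)
    ultimately have "((\<lambda>p. g p * p powr - s) has_sum (\<Sum>S\<in>Pow I. eS S * prime_sum (\<psi>S S) s)) {p. prime p}"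
      by simp
    then have "(\<Sum>S\<in>Pow I. eS S * prime_sum (\<psi>S S) s) = infsum (\<lambda>p. g p * p powr - s) {p. prime p}"
      by (simp add: infsumI)
    also have "\<dots> = infsum (\<lambda>p. g p * p powr - s) {p\<in>F. prime p}"
      by (rule infsum_cong_neutral) (auto simp: g_zero)
    also have "\<dots> = (\<Sum>p | p \<in> F \<and> prime p. g p * p powr - s)"
      using fin by (intro infsum_finite) auto
    also have "\<dots> \<le> (\<Sum>p | p \<in> F \<and> prime p. \<bar>g p\<bar>)"
    proof (rule sum_mono)
      fix p assume "p \<in> {p\<in>F. prime p}"
      then have "real p \<ge> 1" using prime_ge_1_nat by auto
      then have "real p powr - s \<le> real p powr 0" using s by (intro powr_mono) auto
      then have "real p powr - s \<le> 1" using \<open>real p \<ge> 1\<close> by simp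
      then have "\<bar>g p\<bar> * real p powr - s \<le> \<bar>g p\<bar>" by (intro mult_left_le) auto
      moreover have "g p * real p powr - s \<le> \<bar>g p\<bar> * real p powr - s" by (intro mult_right_mono) auto
      ultimately show "g p * real p powr - s \<le> \<bar>g p\<bar>" by linarith
    qed
    also have "\<dots> \<le> (\<Sum>p\<in>F. \<bar>g p\<bar>)" using fin by (intro sum_mono2) auto
    finally have upper: "(\<Sum>S\<in>Pow I. eS S * prime_sum (\<psi>S S) s) \<le> (\<Sum>p\<in>F. \<bar>g p\<bar>)" .
    have "(\<Sum>S\<in>Pow I. eS S * prime_sum (\<psi>S S) s) =
        eS {} * prime_sum (\<psi>S {}) s + (\<Sum>S\<in>Pow I - {{}}. eS S * prime_sum (\<psi>S S) s)"
      using \<open>finite I\<close> by (intro sum.remove) auto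
    moreover have "eS {} * prime_sum (\<psi>S {}) s = prime_sum (\<lambda>_. 1) s"
      by (simp add: eS_def \<psi>S_def)
    moreover have "(\<Sum>S\<in>Pow I - {{}}. - C S) \<le> (\<Sum>S\<in>Pow I - {{}}. eS S * prime_sum (\<psi>S S) s)"
    proof (rule sum_mono)
      fix S assume S: "S \<in> Pow I - {{}}"
      have "\<bar>eS S * prime_sum (\<psi>S S) s\<bar> \<le> C S" using C[OF S s] abs_eS[of S] S by (simp add: abs_mult)
      then show "- C S \<le> eS S * prime_sum (\<psi>S S) s" by linarith
    qed
    ultimately show ?thesis using upper by (simp add: sum_negf)
  qed
  obtain s where "1 < s" "s \<le> 2" "prime_sum (\<lambda>_. 1) s > (\<Sum>p\<in>F. \<bar>g p\<bar>) + (\<Sum>S\<in>Pow I - {{}}. C S)"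
    using prime_sum_unbounded by blast
  with le[of s] show False by simp
qed

text \<open>Multiplication by \<open>a\<close> permutes the residues mod \<open>M\<close> and
  changes the sign of \<open>\<psi>\<close>, so the sum over a period is zero; only an incomplete
  period of fewer than \<open>M\<close> terms remains.\<close>

lemma (in real_character) periodic_bounded_character:
  assumes "M > 0" and per: "\<And>n. \<psi> (n + M) = \<psi> n" and a: "coprime a M" "\<psi> a = -1"
  shows "bounded_character \<psi> M"
proof
  have mod: "\<psi> (n mod M) = \<psi> n" for n
  proof -
    have "\<psi> (r + k * M) = \<psi> r" for r k
      by (induction k) (use per in \<open>auto simp: add.assoc[symmetric] add.commute[of M]\<close>)
    from this[of "n mod M" "n div M"] show ?thesis by simp
  qed
  have inj: "inj_on (\<lambda>n. a * n mod M) {..<M}"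
  proof (rule inj_onI)
    fix x y assume "x \<in> {..<M}" "y \<in> {..<M}" "a * x mod M = a * y mod M"
    moreover from this have "[x = y] (mod M)"
      using cong_mult_lcancel_nat[OF a(1)] by (simp add: cong_def)
    ultimately show "x = y" by (simp add: cong_def)
  qed
  then have "(\<lambda>n. a * n mod M) ` {..<M} = {..<M}"
    using \<open>M > 0\<close> by (intro endo_inj_surj) auto
  then have "(\<Sum>n<M. \<psi> n) = (\<Sum>n<M. \<psi> (a * n mod M))"
    using sum.reindex[OF inj, of \<psi>] by simp
  also have "\<dots> = - (\<Sum>n<M. \<psi> n)" by (simp add: mod mult a(2) sum_negf)
  finally have zero: "(\<Sum>n<M. \<psi> n) = 0" by simp
  have split: "(\<Sum>n<M + k. \<psi> n) = (\<Sum>n<M. \<psi> n) + (\<Sum>n<k. \<psi> (n + M))" for k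
    by (induction k) (simp_all add: add.commute)
  show "\<bar>\<Sum>n<x. \<psi> n\<bar> \<le> real M" for x
  proof (induction x rule: less_induct)
    case (less x)
    show ?case
    proof (cases "x < M")
      case True
      have "\<bar>\<Sum>n<x. \<psi> n\<bar> \<le> (\<Sum>n<x. 1)" by (rule order_trans[OF sum_abs sum_mono]) (rule abs_le_1)
      then show ?thesis using True by simp
    next
      case False
      have "(\<Sum>n<x. \<psi> n) = (\<Sum>n<M + (x - M). \<psi> n)" using False by simp
      also have "\<dots> = (\<Sum>n<M. \<psi> n) + (\<Sum>n<x - M. \<psi> (n + M))"
        by (rule split)
      finally show ?thesis using less.IH[of "x - M"] False \<open>M > 0\<close> by (simp add: zero per)
    qed
  qed
qed

section \<open>Legendre symbols and quadratic characters\<close>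

lemma Legendre_mult:
  fixes p :: nat
  assumes p: "prime p" "odd p"
  shows "Legendre (a * b) p = Legendre a p * Legendre b p"
proof -
  have p2: "p > 2" using p prime_ge_2_nat[of p] by (cases "p = 2") auto
  have "[Legendre (a * b) p = (a * b) ^ ((p - 1) div 2)] (mod p)"
    using euler_criterion[OF p(1) p2] .
  also have "(a * b) ^ ((p - 1) div 2) = a ^ ((p - 1) div 2) * b ^ ((p - 1) div 2)"
    by (rule power_mult_distrib)
  also have "[\<dots> = Legendre a p * Legendre b p] (mod p)"
    using cong_mult[OF euler_criterion[OF p(1) p2, of a] euler_criterion[OF p(1) p2, of b]]
    by (rule cong_sym)
  finally have "int p dvd Legendre (a * b) p - Legendre a p * Legendre b p"
    by (simp add: cong_iff_dvd_diff)
  \<comment> \<open>Both sides lie between -1 and 1, so they differ by at most \<open>2 < p\<close>,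
    and congruence mod \<open>p\<close> forces equality.\<close>
  moreover have "\<bar>Legendre (a * b) p - Legendre a p * Legendre b p\<bar> \<le> 2"
    by (simp add: Legendre_def)
  ultimately show ?thesis
    using p2 dvd_imp_le_int[of "Legendre (a * b) p - Legendre a p * Legendre b p" "int p"] by fastforce
qed

lemma Legendre_cong:
  assumes "[a = b] (mod m)"
  shows "Legendre a m = Legendre b m"
proof -
  have "[c = a] (mod m) \<longleftrightarrow> [c = b] (mod m)" "[a = c] (mod m) \<longleftrightarrow> [b = c] (mod m)" for c
    using assms cong_trans cong_sym by blast+
  then show ?thesis by (simp add: Legendre_def QuadRes_def)
qed

text \<open>Otherwise squaring would cover all nonzero residues and be injective on them by
  counting, although 1 and \<open>p - 1\<close> have the same square.\<close>

lemma exists_nonresidue: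
  fixes p :: nat
  assumes p: "prime p" "odd p"
  shows "\<exists>a :: nat. Legendre (int a) (int p) = -1"
proof (rule ccontr)
  assume contr: "\<nexists>a :: nat. Legendre (int a) (int p) = -1"
  have p2: "p > 2" using p prime_ge_2_nat[of p] by (cases "p = 2") auto
  define f where "f x = x\<^sup>2 mod p" for x
  have "{1..<p} \<subseteq> f ` {1..<p}"
  proof
    fix a assume a: "a \<in> {1..<p}"
    then have "\<not> [int a = 0] (mod int p)" by (auto simp: cong_0_iff dest: dvd_imp_le)
    then have "QuadRes (int p) (int a)" using contr[unfolded not_ex, rule_format, of a] by (auto simp: Legendre_def split: if_splits)
    then obtain y where y: "[y\<^sup>2 = int a] (mod int p)" by (auto simp: QuadRes_def)
    define x where "x = nat (y mod int p)"
    have x: "int x = y mod int p" using p2 by (simp add: x_def)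
    have "x < p" using p2 by (simp add: x_def nat_less_iff)
    moreover have "int (f x) = int a"
      using y a by (simp add: f_def zmod_int x power_mod cong_def)
    moreover from this have "x \<noteq> 0" using a by (intro notI) (simp add: f_def)
    ultimately show "a \<in> f ` {1..<p}" by (intro image_eqI[of _ _ x]) auto
  qed
  then have "card {1..<p} \<le> card (f ` {1..<p})" by (intro card_mono) auto
  then have "inj_on f {1..<p}" by (intro eq_card_imp_inj_on antisym card_image_le) auto
  moreover have "f (p - 1) = f 1"
  proof -
    have "[int (p - 1) ^ 2 = 1 ^ 2] (mod int p)"
      using p2 by (simp add: cong_iff_dvd_diff of_nat_diff power2_eq_square algebra_simps)
    then have "[(p - 1)\<^sup>2 = 1\<^sup>2] (mod p)" by (metis cong_int_iff of_nat_1 of_nat_power)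
    then show ?thesis by (simp add: f_def cong_def)
  qed
  ultimately have "p - 1 = 1" using p2 by (auto dest!: inj_onD)
  then show False using p2 by simp
qed

text \<open>The value \<open>m = 4\<close> selects the nontrivial character mod 4, so that a residue
  class mod 4 and Legendre symbols can be prescribed in the same way. It cannot clash with a prime
  modulus.\<close>

definition quadratic_character :: "nat \<Rightarrow> nat \<Rightarrow> real" where
  "quadratic_character m n =
    (if m = 4 then if n mod 4 = 1 then 1 else if n mod 4 = 3 then -1 else 0
     else of_int (Legendre (int n) (int m)))"

context
  fixes m :: nat
  assumes m: "m = 4 \<or> prime m \<and> odd m"
begin

lemma quadratic_character_periodic:
  assumes "[a = b] (mod m)"
  shows "quadratic_character m a = quadratic_character m b"
  using assms Legendre_cong[of "int a" "int b" "int m"]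
  by (auto simp: quadratic_character_def cong_int_iff) (auto simp: cong_def)

lemma real_character_quadratic_character: "real_character (quadratic_character m)"
proof
  fix a b
  show "quadratic_character m (a * b) = quadratic_character m a * quadratic_character m b"
  proof (cases "m = 4")
    case True
    have "a mod 4 \<in> {0, 1, 2, 3}" "b mod 4 \<in> {0, 1, 2, 3}" by auto
    then show ?thesis using True mod_mult_eq[of a 4 b]
      by (auto simp: quadratic_character_def)
  next
    case False
    then show ?thesis using m by (auto simp: quadratic_character_def Legendre_mult)
  qed
next
  show "quadratic_character m 1 = 1"
  proof (cases "m = 4")
    case False
    have "QuadRes (int m) 1" unfolding QuadRes_def by (intro exI[of _ 1]) simp
    moreover have "\<not> [1 = 0] (mod int m)" using False m by (auto simp: cong_0_iff)
    ultimately show ?thesis using False by (simp add: quadratic_character_def Legendre_def)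
  qed (simp add: quadratic_character_def)
next
  show "quadratic_character m n \<in> {- 1, 0, 1}" for n
    by (simp add: quadratic_character_def Legendre_def)
qed

lemma quadratic_character_eq_0:
  "quadratic_character m n = 0 \<longleftrightarrow> \<not> coprime n m"
proof (cases "m = 4")
  case True
  have "coprime n 4 \<longleftrightarrow> odd n"
    using coprime_power_right_iff[of n 2 2] by (simp add: coprime_right_2_iff_odd)
  moreover have "odd n \<longleftrightarrow> n mod 4 = 1 \<or> n mod 4 = 3" by presburger
  ultimately show ?thesis using True by (auto simp: quadratic_character_def)
next
  case False
  then have "prime m" using m by simp
  have "quadratic_character m n = 0 \<longleftrightarrow> m dvd n"
    using False by (auto simp: quadratic_character_def Legendre_def cong_0_iff)
  moreover have "coprime n m \<longleftrightarrow> \<not> m dvd n"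
    using \<open>prime m\<close> prime_imp_coprime[of m n] coprime_common_divisor[of n m m]
    by (auto simp: coprime_commute)
  ultimately show ?thesis by simp
qed

lemma quadratic_character_minus_1: "\<exists>a. quadratic_character m a = -1"
proof (cases "m = 4")
  case True
  then show ?thesis by (intro exI[of _ 3]) (simp add: quadratic_character_def)
next
  case False
  then obtain a :: nat where "Legendre (int a) (int m) = -1" using m exists_nonresidue by blast
  with False show ?thesis by (intro exI[of _ a]) (simp add: quadratic_character_def)
qed

end

text \<open>The moduli are pairwise coprime, so the Chinese remainder theorem gives an
  \<open>a\<close> at which one chosen factor is -1 and all others are 1. The product then takes the
  value -1 at a unit modulo its period \<open>\<Prod>S\<close>.\<close>

lemma bounded_product_quadratic_characters:
  assumes fin: "finite S" and "S \<noteq> {}" and S: "\<And>m. m \<in> S \<Longrightarrow> m = 4 \<or> prime m \<and> odd m"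
  shows "bounded_character (\<lambda>n. \<Prod>m\<in>S. quadratic_character m n) (real (\<Prod>S))"
proof -
  let ?\<psi> = "\<lambda>n. \<Prod>m\<in>S. quadratic_character m n"
  have char: "real_character (quadratic_character m)" if "m \<in> S" for m
    using real_character_quadratic_character S[OF that] .
  interpret real_character ?\<psi>
  proof
    show "?\<psi> (a * b) = ?\<psi> a * ?\<psi> b" for a b
      by (simp add: prod.distrib[symmetric] real_character.mult[OF char])
    show "?\<psi> 1 = 1" by (rule prod.neutral) (use real_character.one[OF char] in auto)
    have "(\<Prod>m\<in>T. quadratic_character m n) \<in> {-1, 0, 1}" if "finite T" "T \<subseteq> S" for T n
      using that
    proof (induction T rule: finite_induct)
      case (insert m T)
      then show ?case using real_character.vals[OF char, of m n] by auto
    qed simp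
    with fin show "?\<psi> n \<in> {-1, 0, 1}" for n by blast
  qed
  obtain m0 where m0: "m0 \<in> S" using \<open>S \<noteq> {}\<close> by blast
  obtain a0 where a0: "quadratic_character m0 a0 = -1"
    using quadratic_character_minus_1[OF S[OF m0]] by blast
  have cop: "\<forall>m\<in>S. \<forall>m'\<in>S. m \<noteq> m' \<longrightarrow> coprime m m'"
  proof (intro ballI impI)
    fix m m' assume "m \<in> S" "m' \<in> S" "m \<noteq> m'"
    moreover have "coprime 4 q" "coprime q 4" if "odd q" for q :: nat
      using that coprime_power_left_iff[of 2 2 q] coprime_power_right_iff[of q 2 2]
      by (simp_all add: coprime_right_2_iff_odd coprime_left_2_iff_odd)
    ultimately show "coprime m m'" using S[of m] S[of m'] primes_coprime by auto
  qed
  obtain a where a: "\<forall>m\<in>S. [a = (if m = m0 then a0 else 1)] (mod m)"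
    using chinese_remainder_nat[OF fin cop, of "\<lambda>m. if m = m0 then a0 else 1"] by blast
  have "quadratic_character m a = (if m = m0 then -1 else 1)" if "m \<in> S" for m
    using quadratic_character_periodic[OF S[OF that] bspec[OF a that]] a0 real_character.one[OF char[OF that]]
    by auto
  then have "?\<psi> a = (\<Prod>m\<in>S. if m = m0 then -1 else 1)" and nz: "\<And>m. m \<in> S \<Longrightarrow> quadratic_character m a \<noteq> 0"
    by auto
  then have "?\<psi> a = -1" using fin m0 by simp
  moreover have "coprime a (\<Prod>S)"
    by (rule prod_coprime_right) (use nz quadratic_character_eq_0 S in blast)
  moreover have "m > 0" if "m \<in> S" for m using S[OF that] prime_gt_0_nat by auto
  then have "\<Prod>S > 0" by (intro prod_pos) auto
  moreover have "?\<psi> (n + \<Prod>S) = ?\<psi> n" for n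
  proof (rule prod.cong[OF refl])
    fix m assume m: "m \<in> S"
    then have "m dvd \<Prod>S" using fin by (intro dvd_prodI[of S m "\<lambda>x. x", simplified])
    then have "[n + \<Prod>S = n] (mod m)" by (simp add: cong_def mod_add_eq[symmetric] mod_eq_0_iff_dvd)
    then show "quadratic_character m (n + \<Prod>S) = quadratic_character m n"
      by (rule quadratic_character_periodic[OF S[OF m]])
  qed
  ultimately show ?thesis by (intro periodic_bounded_character)
qed

lemma prime_with_prescribed_Legendre:
  assumes fin: "finite Q" and Q: "\<And>q. q \<in> Q \<Longrightarrow> prime q \<and> odd q"
    and e: "\<And>q. q \<in> Q \<Longrightarrow> e q \<in> {1, -1 :: int}" and r: "r \<in> {1, 3 :: nat}"
  shows "\<exists>p. prime p \<and> p mod 4 = r \<and> (\<forall>q\<in>Q. Legendre (int p) (int q) = e q)"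
proof -
  \<comment> \<open>On the odd classes the character mod 4 is 1 for \<open>r = 1\<close> and -1 for
    \<open>r = 3\<close>.\<close>
  define \<epsilon> where "\<epsilon> m = (if m = 4 then if r = 1 then 1 else -1 else real_of_int (e m))" for m
  have S: "m = 4 \<or> prime m \<and> odd m" if "m \<in> insert 4 Q" for m using Q that by auto
  \<comment> \<open>The set \<open>insert 2 Q\<close> holds the primes at which some character
    vanishes: 2 for the modulus 4, and each \<open>q\<close> for its own symbol.\<close>
  have "\<exists>p. prime p \<and> p \<notin> insert 2 Q \<and> (\<forall>m\<in>insert 4 Q. quadratic_character m p = \<epsilon> m)"
  proof (rule prime_with_prescribed_characters)
    show "\<exists>K. bounded_character (\<lambda>n. \<Prod>m\<in>T. quadratic_character m n) K"
      if "T \<subseteq> insert 4 Q" "T \<noteq> {}" for T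
      using bounded_product_quadratic_characters[of T] that S fin by (blast intro: finite_subset)
    show "p \<in> insert 2 Q" if p: "prime p" and m: "m \<in> insert 4 Q" and 0: "quadratic_character m p = 0" for p m
    proof -
      have ncop: "\<not> coprime p m" using quadratic_character_eq_0[OF S[OF m]] 0 by simp
      show ?thesis
      proof (cases "m = 4")
        case True
        then have "even p" using ncop coprime_power_right_iff[of p 2 2] by (simp add: coprime_right_2_iff_odd)
        then show ?thesis using p primes_dvd_imp_eq[of 2 p] by simp
      next
        case False
        then show ?thesis using ncop m S[OF m] p primes_coprime by blast
      qed
    qed
    show "\<epsilon> m \<in> {1, -1}" if "m \<in> insert 4 Q" for m
      using e[of m] that by (auto simp: \<epsilon>_def)
  qed (use S fin in \<open>auto intro: real_character_quadratic_character\<close>)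
  then obtain p where p: "prime p" "\<And>m. m \<in> insert 4 Q \<Longrightarrow> quadratic_character m p = \<epsilon> m" by blast
  have "p mod 4 = r" using p(2)[of 4] r by (auto simp: quadratic_character_def \<epsilon>_def split: if_splits)
  moreover have "Legendre (int p) (int q) = e q" if "q \<in> Q" for q
  proof -
    have "q \<noteq> 4" using Q[OF that] by auto
    then show ?thesis using p(2)[of q] that by (auto simp: quadratic_character_def \<epsilon>_def)
  qed
  ultimately show ?thesis using p(1) by blast
qed

subsection \<open>Sign matrices\<close>

lemma Legendre_reciprocity:
  fixes p q :: nat
  assumes p: "prime p" "odd p" and q: "prime q" "odd q" and "p \<noteq> q"
  shows "Legendre (int q) (int p) =
    (if p mod 4 = 3 \<and> q mod 4 = 3 then - Legendre (int p) (int q) else Legendre (int p) (int q))"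
proof -
  have gt: "p > 2" "q > 2" using p q prime_ge_2_nat[of p] prime_ge_2_nat[of q] by (cases "p = 2"; cases "q = 2"; auto)+
  have half: "even ((r - 1) div 2) \<longleftrightarrow> r mod 4 \<noteq> 3" if "odd r" for r :: nat
    using that by presburger
  have prod: "Legendre (int p) (int q) * Legendre (int q) (int p) = (-1) ^ ((p - 1) div 2 * ((q - 1) div 2))"
    by (rule Quadratic_Reciprocity) (use assms gt in auto)
  also have "\<dots> = (if p mod 4 = 3 \<and> q mod 4 = 3 then -1 else 1)"
    using half[of p] half[of q] p q by (simp add: minus_one_power_iff)
  \<comment> \<open>The product is nonzero, so both symbols are 1 or -1 and each is the other times
    the sign.\<close>
  finally show ?thesis
    by (auto simp: Legendre_def split: if_splits)
qed

text \<open>Induction on the number of primes. The symbols of the new prime over the old ones are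
  prescribed directly; those of the old primes over the new one follow from reciprocity, which has
  the same sign rule as \<open>m\<close> because membership in \<open>T\<close> encodes the class 3
  mod 4.\<close>

lemma primes_with_prescribed_Legendre_matrix:
  fixes m :: "nat \<Rightarrow> nat \<Rightarrow> int"
  assumes "\<And>i j. i < n \<Longrightarrow> j < n \<Longrightarrow> i \<noteq> j \<Longrightarrow> m i j \<in> {1, -1}"
    and "\<And>i j. i < n \<Longrightarrow> j < n \<Longrightarrow> i \<noteq> j \<Longrightarrow> m j i = (if i \<in> T \<and> j \<in> T then - m i j else m i j)"
  shows "\<exists>ps :: nat list. length ps = n \<and> distinct ps \<and> (\<forall>p\<in>set ps. prime p \<and> odd p) \<and>
    (\<forall>i<n. ps ! i mod 4 = (if i \<in> T then 3 else 1)) \<and>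
    (\<forall>i<n. \<forall>j<n. i \<noteq> j \<longrightarrow> Legendre (int (ps ! i)) (int (ps ! j)) = m i j)"
  using assms
proof (induction n)
  case (Suc n)
  have m1: "m i j \<in> {1, -1}" if "i < n" "j < n" "i \<noteq> j" for i j
    using Suc.prems(1) that by simp
  have m2: "m j i = (if i \<in> T \<and> j \<in> T then - m i j else m i j)" if "i < n" "j < n" "i \<noteq> j" for i j
    using Suc.prems(2) that by simp
  obtain ps :: "nat list" where len: "length ps = n" and dist: "distinct ps"
    and prime: "\<forall>p\<in>set ps. prime p \<and> odd p"
    and mod4: "\<forall>i<n. ps ! i mod 4 = (if i \<in> T then 3 else 1)"
    and Leg: "\<forall>i<n. \<forall>j<n. i \<noteq> j \<longrightarrow> Legendre (int (ps ! i)) (int (ps ! j)) = m i j"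
    by (rule exE[OF Suc.IH[OF m1 m2]], assumption+, elim conjE, rule that)
  \<comment> \<open>The last row of \<open>m\<close>, indexed by the earlier primes instead of their
    positions.\<close>
  define e where "e q = m n (inv_into {..<n} ((!) ps) q)" for q
  have inj: "inj_on ((!) ps) {..<n}" using dist len by (simp add: inj_on_nth)
  have e: "e (ps ! j) = m n j" if "j < n" for j
    unfolding e_def using inv_into_f_f[OF inj, of j] that by simp
  have "e q \<in> {1, -1}" if q: "q \<in> set ps" for q
  proof -
    obtain j where "j < n" "q = ps ! j" using q len by (auto simp: in_set_conv_nth)
    then show ?thesis using e Suc.prems(1)[of n j] by simp
  qed
  then have "\<exists>p. prime p \<and> p mod 4 = (if n \<in> T then 3 else 1) \<and> (\<forall>q\<in>set ps. Legendre (int p) (int q) = e q)"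
    by (intro prime_with_prescribed_Legendre) (use prime in simp_all)
  then obtain p where p: "prime p" "p mod 4 = (if n \<in> T then 3 else 1)"
    and Lp: "\<forall>q\<in>set ps. Legendre (int p) (int q) = e q"
    by blast
  have "odd p" using p(2) by (auto split: if_splits) presburger+
  have Lpj: "Legendre (int p) (int (ps ! j)) = m n j" if "j < n" for j
    using bspec[OF Lp, of "ps ! j"] e that len by simp
  \<comment> \<open>The symbol of a prime over itself is 0, whereas the prescribed symbols are 1 or
    -1.\<close>
  have "p \<notin> set ps"
  proof
    assume "p \<in> set ps"
    then obtain j where "j < n" "p = ps ! j" using len by (auto simp: in_set_conv_nth)
    then show False using Lpj[of j] Suc.prems(1)[of n j] by (auto simp: Legendre_def cong_0_iff)
  qed
  have Ljp: "Legendre (int (ps ! j)) (int p) = m j n" if "j < n" for j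
  proof -
    have "ps ! j \<in> set ps" using that len by simp
    then have "Legendre (int (ps ! j)) (int p) = (if p mod 4 = 3 \<and> ps ! j mod 4 = 3 then - m n j else m n j)"
      using Legendre_reciprocity[of p "ps ! j"] p(1) \<open>odd p\<close> prime \<open>p \<notin> set ps\<close> Lpj[OF that] by metis
    then show ?thesis using Suc.prems(2)[of n j] that mod4 p(2) by simp
  qed
  show ?case
  proof (intro exI[of _ "ps @ [p]"] conjI allI impI)
    fix i j assume "i < Suc n" "j < Suc n" "i \<noteq> j"
    then show "Legendre (int ((ps @ [p]) ! i)) (int ((ps @ [p]) ! j)) = m i j"
      using Leg Lpj Ljp len by (auto simp: nth_append less_Suc_eq)
  next
    fix i assume "i < Suc n"
    then show "(ps @ [p]) ! i mod 4 = (if i \<in> T then 3 else 1)"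
      using mod4 p(2) len by (auto simp: nth_append less_Suc_eq)
  qed (use len dist prime p(1) \<open>odd p\<close> \<open>p \<notin> set ps\<close> in auto)
qed simp

text \<open>
  \<open>T\<close> is the index set of the block \<open>A\<close> before the permutation; all three conditions of the theorem are equivalent to the
  existence of such a set.
\<close>
definition skew_exactly_on :: "nat \<Rightarrow> int mat \<Rightarrow> nat set \<Rightarrow> bool" where
  "skew_exactly_on n M T \<longleftrightarrow> T \<subseteq> {..<n} \<and> T \<noteq> {} \<and>
     (\<forall>i<n. \<forall>j<n. i \<noteq> j \<longrightarrow> M $$ (j, i) = (if i \<in> T \<and> j \<in> T then - M $$ (i, j) else M $$ (i, j)))"

text \<open>Covers the symmetric case, in which the skew block must still have size at least 1: a
  single index has no off-diagonal entries.\<close>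

lemma skew_exactly_on_singleton:
  assumes "n > 0" "\<And>i j. i < n \<Longrightarrow> j < n \<Longrightarrow> i \<noteq> j \<Longrightarrow> M $$ (j, i) = M $$ (i, j)"
  shows "skew_exactly_on n M {0}"
  using assms by (auto simp: skew_exactly_on_def)

lemma quadratic_residue_mat_imp_skew:
  assumes "n > 0" "length ps = n" "distinct ps" and ps: "\<forall>p\<in>set ps. prime p \<and> odd p"
  shows "\<exists>T. skew_exactly_on n (quadratic_residue_mat ps) T"
proof -
  let ?M = "quadratic_residue_mat ps"
  define T where "T = {i. i < n \<and> ps ! i mod 4 = 3}"
  have rec: "?M $$ (j, i) = (if i \<in> T \<and> j \<in> T then - ?M $$ (i, j) else ?M $$ (i, j))"
    if "i < n" "j < n" "i \<noteq> j" for i j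
  proof -
    have "ps ! i \<noteq> ps ! j" using that assms by (simp add: nth_eq_iff_index_eq)
    then show ?thesis
      using Legendre_reciprocity[of "ps ! i" "ps ! j"] ps that assms
      by (simp add: quadratic_residue_mat_def T_def)
  qed
  show ?thesis
  proof (cases "T = {}")
    case True
    then have "skew_exactly_on n ?M {0}" using rec \<open>n > 0\<close> by (intro skew_exactly_on_singleton) auto
    then show ?thesis by blast
  next
    case False
    moreover have "T \<subseteq> {..<n}" by (auto simp: T_def)
    ultimately have "skew_exactly_on n ?M T" unfolding skew_exactly_on_def using rec by blast
    then show ?thesis by blast
  qed
qed

lemma skew_imp_quadratic_residue_mat:
  assumes M: "sign_mat n M" and T: "skew_exactly_on n M T"
  shows "\<exists>ps :: nat list. length ps = n \<and> distinct ps \<and>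
      (\<forall>p\<in>set ps. prime p \<and> odd p) \<and> M = quadratic_residue_mat ps"
proof -
  obtain ps :: "nat list" where ps: "length ps = n" "distinct ps" "\<forall>p\<in>set ps. prime p \<and> odd p"
    "\<forall>i<n. \<forall>j<n. i \<noteq> j \<longrightarrow> Legendre (int (ps ! i)) (int (ps ! j)) = M $$ (i, j)"
    using primes_with_prescribed_Legendre_matrix[of n "\<lambda>i j. M $$ (i, j)" T] M T
    by (auto simp: sign_mat_def skew_exactly_on_def)
  have "M = quadratic_residue_mat ps"
  proof (rule eq_matI)
    fix i j assume "i < dim_row (quadratic_residue_mat ps)" "j < dim_col (quadratic_residue_mat ps)"
    then have "i < n" "j < n" using ps by (auto simp: quadratic_residue_mat_def)
    then show "M $$ (i, j) = quadratic_residue_mat ps $$ (i, j)"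
      using ps M by (cases "i = j") (auto simp: quadratic_residue_mat_def sign_mat_def Legendre_def cong_0_iff)
  qed (use M ps in \<open>auto simp: quadratic_residue_mat_def sign_mat_def\<close>)
  with ps show ?thesis by blast
qed

section \<open>Permutation matrices and the block form\<close>

lemma permutation_mat_mult:
  assumes "\<pi> permutes {..<n}" and "P = Matrix.mat n n (\<lambda>(i, j). if i = \<pi> j then 1 else 0 :: int)"
    and "M \<in> carrier_mat n n" "i < n" "j < n"
  shows "(P * M) $$ (\<pi> i, j) = M $$ (i, j)" and "(M * P) $$ (i, j) = M $$ (i, \<pi> j)"
proof -
  have lt: "\<pi> k < n" if "k < n" for k using permutes_in_image[OF assms(1), of k] that by simp
  have inj: "\<pi> k = \<pi> l \<longleftrightarrow> k = l" for k l using permutes_inj[OF assms(1)] by (auto dest: injD)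
  have "(P * M) $$ (\<pi> i, j) = (\<Sum>k\<in>{0..<n}. (if \<pi> i = \<pi> k then 1 else 0) * M $$ (k, j))"
    using assms lt by (simp add: scalar_prod_def)
  also have "\<dots> = (\<Sum>k\<in>{0..<n}. if k = i then M $$ (k, j) else 0)"
    by (rule sum.cong) (auto simp: inj)
  also have "\<dots> = M $$ (i, j)" using assms by simp
  finally show "(P * M) $$ (\<pi> i, j) = M $$ (i, j)" .
  have "(M * P) $$ (i, j) = (\<Sum>k\<in>{0..<n}. M $$ (i, k) * (if k = \<pi> j then 1 else 0))"
    using assms lt by (simp add: scalar_prod_def)
  also have "\<dots> = (\<Sum>k\<in>{0..<n}. if k = \<pi> j then M $$ (i, k) else 0)"
    by (rule sum.cong) auto
  also have "\<dots> = M $$ (i, \<pi> j)" using assms lt by simp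
  finally show "(M * P) $$ (i, j) = M $$ (i, \<pi> j)" .
qed

lemma block_form_imp_skew:
  assumes s: "s \<in> {1..n}" and A: "sign_mat s A" "skew_symmetric_mat A"
    and S: "sign_mat (n - s) S" "symmetric_mat S"
    and B: "B \<in> carrier_mat s (n - s)" and P: "permutation_mat n P" and M: "M \<in> carrier_mat n n"
    and sim: "similar_mat_wit (four_block_mat A B (transpose_mat B) S) M P Q"
  shows "\<exists>T. skew_exactly_on n M T"
proof -
  obtain \<pi> where \<pi>: "\<pi> permutes {..<n}" "P = Matrix.mat n n (\<lambda>(i, j). if i = \<pi> j then 1 else 0)"
    using P by (auto simp: permutation_mat_def)
  define D where "D = four_block_mat A B (transpose_mat B) S"
  have dims: "A \<in> carrier_mat s s" "S \<in> carrier_mat (n - s) (n - s)"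
    using A S by (auto simp: sign_mat_def)
  have D: "D \<in> carrier_mat n n"
    unfolding D_def using four_block_carrier_mat[OF dims, of B "transpose_mat B"] s by simp
  note wit = similar_mat_witD2[OF D sim[folded D_def]]
  have PM: "P * M \<in> carrier_mat n n" by (rule mult_carrier_mat[OF wit(6,5)])
  \<comment> \<open>Moving \<open>Q\<close> to the other side leaves products with \<open>P\<close>
    alone; comparing entries of \<open>D * P\<close> and \<open>P * M\<close> then gives
    \<open>M $$ (i, j) = D $$ (\<pi> i, \<pi> j)\<close>.\<close>
  have "D * P = P * M * Q * P" using wit(3) by simp
  also have "\<dots> = P * M * (Q * P)" by (rule assoc_mult_mat[OF PM wit(7,6)])
  also have "\<dots> = P * M" unfolding wit(2) by (rule right_mult_one_mat[OF PM])
  finally have DP: "D * P = P * M" .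
  have lt: "\<pi> k < n" if "k < n" for k using permutes_in_image[OF \<pi>(1), of k] that by simp
  have MD: "M $$ (i, j) = D $$ (\<pi> i, \<pi> j)" if "i < n" "j < n" for i j
    using permutation_mat_mult(1)[OF \<pi> M that] permutation_mat_mult(2)[OF \<pi> D lt[OF that(1)] that(2)] DP
    by simp
  have Aij: "A $$ (j, i) = - A $$ (i, j)" if "i < s" "j < s" for i j
  proof -
    have "transpose_mat A $$ (i, j) = (- A) $$ (i, j)" using A(2) by (simp add: skew_symmetric_mat_def)
    then show ?thesis using that dims by simp
  qed
  have Sij: "S $$ (j, i) = S $$ (i, j)" if "i < n - s" "j < n - s" for i j
  proof -
    have "transpose_mat S $$ (i, j) = S $$ (i, j)" using S(2) by (simp add: symmetric_mat_def)
    then show ?thesis using that dims by simp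
  qed
  have D_entry: "D $$ (i, j) = (if i < s then if j < s then A $$ (i, j) else B $$ (i, j - s)
      else if j < s then B $$ (j, i - s) else S $$ (i - s, j - s))" if "i < n" "j < n" for i j
    using that s dims B by (auto simp: D_def)
  have Dij: "D $$ (j, i) = (if i < s \<and> j < s then - D $$ (i, j) else D $$ (i, j))" if "i < n" "j < n" for i j
    using D_entry[OF that] D_entry[OF that(2,1)] Aij[of i j] Sij[of "i - s" "j - s"] that s
    by (cases "i < s"; cases "j < s") auto
  define T where "T = {i. i < n \<and> \<pi> i < s}"
  \<comment> \<open>The index sent to 0 lies in \<open>T\<close> because
    \<open>s \<ge> 1\<close>.\<close>
  obtain k where "\<pi> k = 0" using permutes_surj[OF \<pi>(1)] by (metis surjD)
  moreover from this have "k < n" using permutes_in_image[OF \<pi>(1), of k] s by simp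
  ultimately have "k \<in> T" using s by (simp add: T_def)
  moreover have "M $$ (j, i) = (if i \<in> T \<and> j \<in> T then - M $$ (i, j) else M $$ (i, j))"
    if "i < n" "j < n" for i j
    using Dij[OF lt[OF that(1)] lt[OF that(2)]] that by (simp add: MD T_def)
  moreover have "T \<subseteq> {..<n}" by (auto simp: T_def)
  ultimately have "skew_exactly_on n M T" unfolding skew_exactly_on_def by blast
  then show ?thesis by blast
qed

lemma permutation_onto_initial_segment:
  assumes "T \<subseteq> {..<n}"
  shows "\<exists>\<pi>. \<pi> permutes {..<n} \<and> (\<forall>i<n. \<pi> i < card T \<longleftrightarrow> i \<in> T)"
proof -
  have fin: "finite T" using assms finite_subset by blast
  have "card ({..<n} - T) = card {card T..<n}" using assms fin by (simp add: card_Diff_subset)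
  then obtain g where g: "bij_betw g ({..<n} - T) {card T..<n}"
    using finite_same_card_bij[of "{..<n} - T" "{card T..<n}"] by auto
  obtain f where f: "bij_betw f T {..<card T}"
    using finite_same_card_bij[OF fin, of "{..<card T}"] by auto
  define h where "h i = (if i \<in> T then f i else g i)" for i
  define \<pi> where "\<pi> i = (if i < n then h i else i)" for i
  have cT: "card T \<le> n" using card_mono[OF _ assms] by simp
  have "bij_betw h (T \<union> ({..<n} - T)) ({..<card T} \<union> {card T..<n})"
    unfolding h_def by (rule bij_betw_disjoint_Un[OF f g]) auto
  also have "T \<union> ({..<n} - T) = {..<n}" using assms by auto
  also have "{..<card T} \<union> {card T..<n} = {..<n}" using cT by auto
  finally have "bij_betw \<pi> {..<n} {..<n}"
    by (rule bij_betw_cong[THEN iffD1, rotated]) (simp add: \<pi>_def)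
  then have "\<pi> permutes {..<n}" by (rule bij_imp_permutes) (simp add: \<pi>_def)
  moreover have "\<pi> i < card T \<longleftrightarrow> i \<in> T" if "i < n" for i
    using bspec[OF bij_betwE[OF f], of i] bspec[OF bij_betwE[OF g], of i] that
    by (cases "i \<in> T") (simp_all add: \<pi>_def h_def)
  ultimately show ?thesis by blast
qed

lemma skew_imp_block_form:
  assumes M: "sign_mat n M" and T: "skew_exactly_on n M T"
  shows "\<exists>s\<in>{1..n}. \<exists>A B S P Q.
      sign_mat s A \<and> skew_symmetric_mat A \<and>
      sign_mat (n - s) S \<and> symmetric_mat S \<and>
      B \<in> carrier_mat s (n - s) \<and> (\<forall>i<s. \<forall>j<n - s. B $$ (i, j) \<in> {1, -1}) \<and>
      permutation_mat n P \<and>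
      similar_mat_wit (four_block_mat A B (transpose_mat B) S) M P Q"
proof -
  define s where "s = card T"
  have Tn: "T \<subseteq> {..<n}" "T \<noteq> {}" using T by (auto simp: skew_exactly_on_def)
  then have s: "s \<in> {1..n}"
    using card_mono[of "{..<n}" T] finite_subset[of T "{..<n}"] by (auto simp: s_def Suc_le_eq card_gt_0_iff)
  obtain \<pi> where \<pi>: "\<pi> permutes {..<n}" and \<pi>T: "\<And>i. i < n \<Longrightarrow> \<pi> i < s \<longleftrightarrow> i \<in> T"
    using permutation_onto_initial_segment[OF Tn(1)] unfolding s_def by blast
  define \<sigma> where "\<sigma> = inv_into UNIV \<pi>"
  have \<sigma>: "\<sigma> permutes {..<n}" unfolding \<sigma>_def by (rule permutes_inv[OF \<pi>])
  have \<pi>\<sigma>: "\<pi> (\<sigma> i) = i" "\<sigma> (\<pi> i) = i" for i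
    unfolding \<sigma>_def using permutes_inverses[OF \<pi>] by auto
  have lt: "\<pi> i < n" "\<sigma> i < n" if "i < n" for i
    using permutes_in_image[OF \<pi>, of i] permutes_in_image[OF \<sigma>, of i] that by auto
  have \<sigma>T: "\<sigma> i \<in> T \<longleftrightarrow> i < s" if "i < n" for i using \<pi>T[OF lt(2)[OF that]] by (simp add: \<pi>\<sigma>)
  \<comment> \<open>The matrix \<open>M\<close> with rows and columns reordered so that the indices
    of \<open>T\<close> come first; the blocks below are cut from it.\<close>
  define d where "d i j = M $$ (\<sigma> i, \<sigma> j)" for i j
  have \<sigma>_eq: "\<sigma> i = \<sigma> j \<longleftrightarrow> i = j" for i j using \<pi>\<sigma>(1) by metis
  have Mc: "M \<in> carrier_mat n n" using M by (simp add: sign_mat_def)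
  have diag: "d i i = 0" if "i < n" for i using M lt that by (simp add: d_def sign_mat_def)
  have entry: "d i j \<in> {1, -1}" if "i < n" "j < n" "i \<noteq> j" for i j
    using M lt that unfolding d_def sign_mat_def by (simp add: \<sigma>_eq)
  have swap: "d j i = (if i < s \<and> j < s then - d i j else d i j)" if "i < n" "j < n" for i j
  proof (cases "i = j")
    case False
    then show ?thesis
      using T lt that \<sigma>T unfolding d_def skew_exactly_on_def by (simp add: \<sigma>_eq)
  qed (use diag that in simp)
  define A where "A = Matrix.mat s s (\<lambda>(i, j). d i j)"
  define B where "B = Matrix.mat s (n - s) (\<lambda>(i, j). d i (j + s))"
  define S where "S = Matrix.mat (n - s) (n - s) (\<lambda>(i, j). d (i + s) (j + s))"
  define D where "D = four_block_mat A B (transpose_mat B) S"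
  define P where "P = Matrix.mat n n (\<lambda>(i, j). if i = \<pi> j then 1 else 0 :: int)"
  define Q where "Q = Matrix.mat n n (\<lambda>(i, j). if i = \<sigma> j then 1 else 0 :: int)"
  have Dc: "D \<in> carrier_mat n n" using s by (auto simp: D_def A_def B_def S_def)
  have Pc: "P \<in> carrier_mat n n" "Q \<in> carrier_mat n n" by (auto simp: P_def Q_def)
  \<comment> \<open>In the lower left block \<open>swap\<close> applies without a sign, which makes
    that block the transpose of \<open>B\<close>.\<close>
  have Dij: "D $$ (i, j) = d i j" if "i < n" "j < n" for i j
    using that s swap[of i j] by (auto simp: D_def A_def B_def S_def)
  have PQ: "P * Q = 1\<^sub>m n"
  proof (rule eq_matI)
    fix i j assume ij: "i < dim_row (1\<^sub>m n)" "j < dim_col (1\<^sub>m n)"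
    then have "(P * Q) $$ (\<pi> (\<sigma> i), j) = Q $$ (\<sigma> i, j)"
      using lt by (intro permutation_mat_mult(1)[OF \<pi> P_def Pc(2)]) auto
    then show "(P * Q) $$ (i, j) = 1\<^sub>m n $$ (i, j)" using ij lt by (simp add: \<pi>\<sigma> Q_def \<sigma>_eq)
  qed (use Pc in auto)
  have QP: "Q * P = 1\<^sub>m n"
  proof (rule eq_matI)
    fix i j assume ij: "i < dim_row (1\<^sub>m n)" "j < dim_col (1\<^sub>m n)"
    then have "(Q * P) $$ (i, j) = Q $$ (i, \<pi> j)"
      by (intro permutation_mat_mult(2)[OF \<pi> P_def Pc(2)]) auto
    then show "(Q * P) $$ (i, j) = 1\<^sub>m n $$ (i, j)" using ij lt by (simp add: \<pi>\<sigma> Q_def)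
  qed (use Pc in auto)
  have "D = P * M * Q"
  proof (rule eq_matI)
    fix i j assume "i < dim_row (P * M * Q)" "j < dim_col (P * M * Q)"
    then have ij: "i < n" "j < n" using Pc by auto
    have "(P * M * Q) $$ (i, j) = (P * M) $$ (i, \<sigma> j)"
      using Pc Mc ij by (intro permutation_mat_mult(2)[OF \<sigma> Q_def]) auto
    also have "\<dots> = (P * M) $$ (\<pi> (\<sigma> i), \<sigma> j)" by (simp add: \<pi>\<sigma>)
    also have "\<dots> = d i j" unfolding d_def
      using ij lt by (intro permutation_mat_mult(1)[OF \<pi> P_def Mc]) auto
    finally show "D $$ (i, j) = (P * M * Q) $$ (i, j)" using Dij ij by simp
  qed (use Dc Pc in auto)
  then have "similar_mat_wit D M P Q"
    using Dc Mc Pc PQ QP by (intro similar_mat_witI[where n = n]) auto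
  moreover have "permutation_mat n P" using \<pi> by (auto simp: permutation_mat_def P_def)
  moreover have "sign_mat s A" using diag entry s by (auto simp: sign_mat_def A_def)
  moreover have "sign_mat (n - s) S" using diag entry s by (auto simp: sign_mat_def S_def)
  moreover have "\<forall>i<s. \<forall>j<n - s. B $$ (i, j) \<in> {1, -1}" using entry s by (auto simp: B_def)
  moreover have "skew_symmetric_mat A" unfolding skew_symmetric_mat_def
  proof (rule eq_matI)
    fix i j assume "i < dim_row (- A)" "j < dim_col (- A)"
    then show "transpose_mat A $$ (i, j) = (- A) $$ (i, j)"
      using swap[of i j] s by (simp add: A_def)
  qed (auto simp: A_def)
  moreover have "symmetric_mat S" unfolding symmetric_mat_def
  proof (rule eq_matI)
    fix i j assume "i < dim_row S" "j < dim_col S"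
    then show "transpose_mat S $$ (i, j) = S $$ (i, j)"
      using swap[of "i + s" "j + s"] s by (simp add: S_def)
  qed (auto simp: S_def)
  moreover have "B \<in> carrier_mat s (n - s)" by (simp add: B_def)
  ultimately show ?thesis using s unfolding D_def by blast
qed

section \<open>The diagonal of the square\<close>

definition skew_partners :: "nat \<Rightarrow> int mat \<Rightarrow> nat \<Rightarrow> nat set" where
  "skew_partners n M i = {j. j < n \<and> j \<noteq> i \<and> M $$ (j, i) = - M $$ (i, j)}"

lemma diag_mat_square:
  assumes M: "sign_mat n M"
  shows "diag_mat (M ^\<^sub>m 2) = map (\<lambda>i. int n - 1 - 2 * int (card (skew_partners n M i))) [0..<n]"
proof -
  have Mc: "M \<in> carrier_mat n n" using M by (simp add: sign_mat_def)
  have sq: "M ^\<^sub>m 2 = M * M" using Mc by (simp add: numeral_2_eq_2)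
  have "(M * M) $$ (i, i) = int n - 1 - 2 * int (card (skew_partners n M i))" if i: "i < n" for i
  proof -
    let ?N = "skew_partners n M i"
    have N: "?N \<subseteq> {0..<n} - {i}" by (auto simp: skew_partners_def)
    have "(M * M) $$ (i, i) = (\<Sum>j\<in>{0..<n}. M $$ (i, j) * M $$ (j, i))"
      using Mc i by (simp add: scalar_prod_def)
    also have "\<dots> = (\<Sum>j\<in>{0..<n} - {i}. M $$ (i, j) * M $$ (j, i))"
      using M i by (intro sum.mono_neutral_right) (auto simp: sign_mat_def)
    also have "\<dots> = (\<Sum>j\<in>{0..<n} - {i}. 1 - 2 * (if j \<in> ?N then 1 else 0))"
    proof (rule sum.cong[OF refl])
      fix j assume j: "j \<in> {0..<n} - {i}"
      then have "M $$ (i, j) \<in> {1, -1}" "M $$ (j, i) \<in> {1, -1}"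
        using M i unfolding sign_mat_def by auto
      then show "M $$ (i, j) * M $$ (j, i) = 1 - 2 * (if j \<in> ?N then 1 else 0)"
        using j by (auto simp: skew_partners_def)
    qed
    also have "\<dots> = (\<Sum>j\<in>{0..<n} - {i}. 1) - 2 * (\<Sum>j\<in>{0..<n} - {i}. if j \<in> ?N then 1 else 0)"
      unfolding sum_subtractf sum_distrib_left ..
    also have "(\<Sum>j\<in>{0..<n} - {i}. if j \<in> ?N then 1 else 0) = int (card ?N)"
      using N by (simp add: sum.If_cases Int_absorb1 Int_absorb2)
    finally show ?thesis using i by (simp add: of_nat_diff)
  qed
  then show ?thesis using Mc unfolding sq diag_mat_def by simp
qed

lemma skew_exactly_on_partners:
  assumes M: "sign_mat n M" and T: "skew_exactly_on n M T" and i: "i < n"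
  shows "skew_partners n M i = (if i \<in> T then T - {i} else {})"
proof -
  have "j \<in> skew_partners n M i \<longleftrightarrow> i \<in> T \<and> j \<in> T - {i}" for j
  proof (cases "j < n \<and> j \<noteq> i")
    case True
    \<comment> \<open>A nonzero entry is not its own negative, so a pair not contained in
      \<open>T\<close> is not a skew pair.\<close>
    then have "M $$ (i, j) \<in> {1, -1}" using M i unfolding sign_mat_def by simp
    moreover have "M $$ (j, i) = (if i \<in> T \<and> j \<in> T then - M $$ (i, j) else M $$ (i, j))"
      using T i True unfolding skew_exactly_on_def by simp
    ultimately show ?thesis using True by (auto simp: skew_partners_def)
  next
    case False
    then show ?thesis using T by (auto simp: skew_partners_def skew_exactly_on_def)
  qed
  then show ?thesis by auto
qed

lemma skew_imp_diag:
  assumes M: "sign_mat n M" and T: "skew_exactly_on n M T"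
  shows "\<exists>s\<in>{1..n}. mset (diag_mat (M ^\<^sub>m 2)) =
      replicate_mset s (int n + 1 - 2 * int s) + replicate_mset (n - s) (int n - 1)"
proof -
  have Tn: "T \<subseteq> {0..<n}" "T \<noteq> {}" using T by (auto simp: skew_exactly_on_def)
  have fin: "finite T" using Tn finite_subset by blast
  have card: "1 \<le> card T" "card T \<le> n"
    using card_mono[OF _ Tn(1)] fin Tn(2) by (auto simp: Suc_le_eq card_gt_0_iff)
  define k where "k i = int n - 1 - 2 * int (card (skew_partners n M i))" for i
  \<comment> \<open>An index in \<open>T\<close> is not its own partner, so it has
    \<open>card T - 1\<close> partners, and
    \<open>n - 1 - 2 * (card T - 1) = n + 1 - 2 * card T\<close>.\<close>
  have kT: "k i = int n + 1 - 2 * int (card T)" if "i \<in> T" for i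
    using skew_exactly_on_partners[OF M T, of i] that Tn fin card by (auto simp: k_def of_nat_diff)
  have kS: "k i = int n - 1" if "i \<in> {0..<n} - T" for i
    using skew_exactly_on_partners[OF M T, of i] that by (simp add: k_def)
  have "mset (diag_mat (M ^\<^sub>m 2)) = image_mset k (mset_set {0..<n})"
    unfolding diag_mat_square[OF M] k_def by simp
  also have "mset_set {0..<n} = mset_set T + mset_set ({0..<n} - T)"
    using Tn fin by (subst mset_set_Union[symmetric]) (auto simp: Un_absorb1)
  also have "image_mset k \<dots> = image_mset (\<lambda>_. int n + 1 - 2 * int (card T)) (mset_set T)
      + image_mset (\<lambda>_. int n - 1) (mset_set ({0..<n} - T))"
    unfolding image_mset_union using kT kS fin
    by (intro arg_cong2[of _ _ _ _ "(+)"] image_mset_cong) auto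
  also have "\<dots> = replicate_mset (card T) (int n + 1 - 2 * int (card T)) + replicate_mset (n - card T) (int n - 1)"
    using Tn fin by (simp add: image_mset_const_eq card_Diff_subset)
  finally show ?thesis using card by (intro bexI[of _ "card T"]) auto
qed

lemma diag_imp_skew:
  assumes "n > 0" and M: "sign_mat n M" and s: "s \<in> {1..n}"
    and diag: "mset (diag_mat (M ^\<^sub>m 2)) =
      replicate_mset s (int n + 1 - 2 * int s) + replicate_mset (n - s) (int n - 1)"
  shows "\<exists>T. skew_exactly_on n M T"
proof -
  define k where "k i = card (skew_partners n M i)" for i
  have fin: "finite (skew_partners n M i)" for i by (simp add: skew_partners_def)
  have eq: "image_mset (\<lambda>i. int n - 1 - 2 * int (k i)) (mset_set {0..<n}) =
      replicate_mset s (int n + 1 - 2 * int s) + replicate_mset (n - s) (int n - 1)"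
    using diag unfolding diag_mat_square[OF M] k_def by simp
  have k_cases: "k i = s - 1 \<or> k i = 0" if "i < n" for i
  proof -
    have "int n - 1 - 2 * int (k i) \<in># image_mset (\<lambda>i. int n - 1 - 2 * int (k i)) (mset_set {0..<n})"
      using that by simp
    then have "int n - 1 - 2 * int (k i) = int n + 1 - 2 * int s \<or> int n - 1 - 2 * int (k i) = int n - 1"
      unfolding eq by (auto simp: in_replicate_mset split: if_splits)
    then show ?thesis by linarith
  qed
  have skew: "M $$ (j, i) = (if j \<in> skew_partners n M i then - M $$ (i, j) else M $$ (i, j))"
    if "i < n" "j < n" "i \<noteq> j" for i j
  proof -
    have "M $$ (i, j) \<in> {1, -1}" "M $$ (j, i) \<in> {1, -1}" using M that unfolding sign_mat_def by auto
    then show ?thesis using that by (auto simp: skew_partners_def)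
  qed
  show ?thesis
  \<comment> \<open>For \<open>s = 1\<close> the two diagonal values coincide and no index has a
    partner, so \<open>M\<close> is symmetric.\<close>
  proof (cases "s = 1")
    case True
    then have "skew_partners n M i = {}" if "i < n" for i
      using k_cases[OF that] fin by (auto simp: k_def)
    then have "M $$ (j, i) = M $$ (i, j)" if "i < n" "j < n" "i \<noteq> j" for i j
      using skew[OF that] that(1) by simp
    then have "skew_exactly_on n M {0}" using \<open>n > 0\<close> by (intro skew_exactly_on_singleton)
    then show ?thesis by blast
  next
    case False
    define T where "T = {i. i < n \<and> k i \<noteq> 0}"
    have T_eq: "T = {i. i < n \<and> int n - 1 - 2 * int (k i) = int n + 1 - 2 * int s}"
      using k_cases False s by (fastforce simp: T_def)
    \<comment> \<open>For \<open>s \<noteq> 1\<close> the two values differ, so the multiplicity of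
      the first one counts the elements of \<open>T\<close>.\<close>
    have "count (image_mset (\<lambda>i. int n - 1 - 2 * int (k i)) (mset_set {0..<n})) (int n + 1 - 2 * int s) = s"
      unfolding eq using False s by (auto simp: count_replicate_mset)
    moreover have "{0..<n} \<inter> (\<lambda>i. int n - 1 - 2 * int (k i)) -` {int n + 1 - 2 * int s} = T"
      unfolding T_eq by auto
    ultimately have "(\<Sum>i\<in>T. count (mset_set {0..<n}) i) = s"
      by (simp add: count_image_mset Int_commute)
    moreover have "(\<Sum>i\<in>T. count (mset_set {0..<n}) i) = (\<Sum>i\<in>T. 1)"
      by (rule sum.cong) (auto simp: T_def)
    ultimately have card: "card T = s" by simp
    \<comment> \<open>Partnership is symmetric, so the partners of \<open>i\<close> have a partner
      themselves and lie in \<open>T\<close>; there are \<open>s - 1\<close> of them, as many as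
      \<open>T - {i}\<close> has elements.\<close>
    have partners: "skew_partners n M i = T - {i}" if "i \<in> T" for i
    proof (rule card_subset_eq)
      have i: "i < n" using that by (simp add: T_def)
      show "finite (T - {i})" by (simp add: T_def)
      show "skew_partners n M i \<subseteq> T - {i}"
      proof
        fix j assume j: "j \<in> skew_partners n M i"
        then have "i \<in> skew_partners n M j" using i by (auto simp: skew_partners_def)
        then have "k j \<noteq> 0" using fin by (auto simp: k_def)
        then show "j \<in> T - {i}" using j by (auto simp: T_def skew_partners_def)
      qed
      have "k i = s - 1" using k_cases[OF i] that by (auto simp: T_def)
      then show "card (skew_partners n M i) = card (T - {i})" using card that by (simp add: k_def T_def)
    qed
    have empty: "skew_partners n M i = {}" if "i < n" "i \<notin> T" for i
      using that fin by (auto simp: T_def k_def)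
    have skew_T: "M $$ (j, i) = (if i \<in> T \<and> j \<in> T then - M $$ (i, j) else M $$ (i, j))"
      if "i < n" "j < n" "i \<noteq> j" for i j
      using skew[OF that] partners[of i] empty[OF that(1)] that(3) by (cases "i \<in> T") auto
    have "T \<noteq> {}" using card s by auto
    moreover have "T \<subseteq> {..<n}" by (auto simp: T_def)
    ultimately have "skew_exactly_on n M T"
      using skew_T unfolding skew_exactly_on_def by blast
    then show ?thesis by blast
  qed
qed

theorem theorem1:
  fixes n :: nat and M :: "int mat"
  assumes "n > 1" and "sign_mat n M"
  defines "a \<equiv> \<exists>s\<in>{1..n}. \<exists>A B S P Q.
      sign_mat s A \<and> skew_symmetric_mat A \<and>
      sign_mat (n - s) S \<and> symmetric_mat S \<and>
      B \<in> carrier_mat s (n - s) \<and> (\<forall>i<s. \<forall>j<n - s. B $$ (i, j) \<in> {1, -1}) \<and>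
      permutation_mat n P \<and>
      similar_mat_wit (four_block_mat A B (transpose_mat B) S) M P Q"
  defines "b \<equiv> \<exists>ps :: nat list. length ps = n \<and> distinct ps \<and>
      (\<forall>p\<in>set ps. prime p \<and> odd p) \<and> M = quadratic_residue_mat ps"
  defines "c \<equiv> \<exists>s\<in>{1..n}. mset (diag_mat (M ^\<^sub>m 2)) =
      replicate_mset s (int n + 1 - 2 * int s) + replicate_mset (n - s) (int n - 1)"
  shows "(a \<longleftrightarrow> b) \<and> (b \<longleftrightarrow> c)"
proof -
  have n: "n > 0" using assms(1) by simp
  have M: "M \<in> carrier_mat n n" using assms(2) by (simp add: sign_mat_def)
  have "a \<longleftrightarrow> (\<exists>T. skew_exactly_on n M T)"
    unfolding a_def using block_form_imp_skew[OF _ _ _ _ _ _ _ M] skew_imp_block_form[OF assms(2)] by blast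
  moreover have "b \<longleftrightarrow> (\<exists>T. skew_exactly_on n M T)"
  proof
    assume b
    then show "\<exists>T. skew_exactly_on n M T"
      unfolding b_def by (elim exE conjE) (simp add: quadratic_residue_mat_imp_skew n)
  next
    assume "\<exists>T. skew_exactly_on n M T"
    then show b unfolding b_def by (elim exE) (rule skew_imp_quadratic_residue_mat[OF assms(2)])
  qed
  moreover have "c \<longleftrightarrow> (\<exists>T. skew_exactly_on n M T)"
  proof
    assume c
    then show "\<exists>T. skew_exactly_on n M T"
      unfolding c_def by (elim bexE) (rule diag_imp_skew[OF n assms(2)])
  next
    assume "\<exists>T. skew_exactly_on n M T"
    then show c unfolding c_def by (elim exE) (rule skew_imp_diag[OF assms(2)])
  qed
  ultimately show ?thesis by simp
qed

end
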